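(* Let $\mathbb{B}$ be an infinite Boolean algebra such that the space $L = \mathrm{Ult}(\mathbb{B})$ carries a structure of a modest topological semilattice. Assume further that there exists a set of cardinality $< |\mathbb{B}|$ which is topologically dense in $\max L$. Then for every regular cardinal $\lambda \leq |\mathbb{B}|$ there exists a closed discrete set in $\langle \mathbb{B}, \tau_p\rangle$ of cardinality $\lambda$. In particular, if $|\mathbb{B}|$ is an uncountable regular cardinal, then for every generating set $G \subseteq \mathbb{B}$ there exists $p \in \mathrm{Ult}(\mathbb{B})$ such that $|p \cap G| = |\mathbb{B}|$, that is, $\mathbb{B}$ is not $\kappa$-Corson for $\kappa = |\mathbb{B}|$.
   Context: $\mathrm{Ult}(\mathbb{B})$ is the space of ultrafilters of $\mathbb{B}$ with the Stone topology. The pointwise topology $\tau_p$ on $\mathbb{B}$ is the topology with subbase consisting of the sets $V_q^+ = \{a \in \mathbb{B} : a \in q\}$ and $V_q^- = \{a \in \mathbb{B} : a \notin q\}$ for $q \in \mathrm{Ult}(\mathbb{B})$. A Boolean algebra $\mathbb{B}$ is $\kappa$-Corson if there is a set $G \subseteq \mathbb{B}$ generating $\mathbb{B}$ as a Boolean algebra such that $|G \cap p| < \kappa$ for every $p \in \mathrm{Ult}(\mathbb{B})$. A compact $0$-dimensional semilattice $\langle L, \wedge, 0, \tau\rangle$ is a meet-semilattice with a compact Hausdorff $0$-dimensional topology $\tau$ for which the operation $\wedge : L\times L \to L$ is continuous; its order is $x \leq y \iff x \wedge y = x$, and $0$ is its smallest element. An element $a \in L$ is compact if $a > 0$ and for every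 $S \subseteq L$, $\sup S = a$ implies that there is a finite $F \subseteq S$ with $\sup F = a$ (equivalently, $\{x\in L: x \geq a\}$ is clopen and $a>0$). $L$ is modest if for every compact element $a \in L$ the set of its immediate predecessors is finite (so for every compact element $a$ there is a finite set $I_a$ of elements $<a$ such that each $x < a$ satisfies $x \leq c$ for some $c \in I_a$). "The space $L=\mathrm{Ult}(\mathbb{B})$ carries a structure of a modest topological semilattice" means there is an operation $\wedge$ making $L$, with its Stone topology, a modest compact $0$-dimensional semilattice. $\max L$ is the set of all maximal elements of $L$, with the subspace topology; the dense set is a subset of $\max L$. *)

theory Defs
  imports "HOL-Analysis.Analysis"
begin

unbundle cardinal_syntax

section \<open>Ultrafilters of a Boolean algebra\<close>

definition proper_filter :: "'a::boolean_algebra set \<Rightarrow> bool" where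
  "proper_filter p \<longleftrightarrow>
     top \<in> p \<and> bot \<notin> p \<and>
     (\<forall>a\<in>p. \<forall>b\<in>p. inf a b \<in> p) \<and>
     (\<forall>a\<in>p. \<forall>b. a \<le> b \<longrightarrow> b \<in> p)"

definition Ult :: "'a::boolean_algebra set set" where
  "Ult = {p. proper_filter p \<and> (\<forall>q. proper_filter q \<longrightarrow> p \<subseteq> q \<longrightarrow> q = p)}"

text \<open>The topology generated by a family has the union of the family as its underlying set;
  here this is \<open>Ult\<close>, since \<open>top\<close> belongs to every ultrafilter.\<close>

definition stone_topology :: "'a::boolean_algebra set topology" where
  "stone_topology = topology_generated_by {{p \<in> Ult. a \<in> p} | a. True}"

text \<open>\<open>UNIV\<close> is added to the subbase only to make the underlying set the whole algebra also in
  the trivial case in which there are no ultrafilters.\<close>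

definition pointwise_topology :: "'a::boolean_algebra topology" where
  "pointwise_topology =
     topology_generated_by (insert UNIV ((\<lambda>q. {a. a \<in> q}) ` Ult \<union> (\<lambda>q. {a. a \<notin> q}) ` Ult))"

definition closed_discrete_in :: "'x topology \<Rightarrow> 'x set \<Rightarrow> bool" where
  "closed_discrete_in X D \<longleftrightarrow> closedin X D \<and> subtopology X D = discrete_topology D"


section \<open>Generating sets and the Corson property\<close>

definition boolean_subalgebra :: "'a::boolean_algebra set \<Rightarrow> bool" where
  "boolean_subalgebra S \<longleftrightarrow>
     bot \<in> S \<and> top \<in> S \<and> (\<forall>a\<in>S. - a \<in> S) \<and>
     (\<forall>a\<in>S. \<forall>b\<in>S. inf a b \<in> S \<and> sup a b \<in> S)"

definition generates_algebra :: "'a::boolean_algebra set \<Rightarrow> bool" where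
  "generates_algebra G \<longleftrightarrow> boolean_subalgebra hull G = UNIV"

text \<open>Cardinal numbers are cardinal orders. The algebra is the whole type \<open>'a\<close>, which is passed
  as an \<open>itself\<close> argument.\<close>

definition corson :: "'a::boolean_algebra itself \<Rightarrow> 'k rel \<Rightarrow> bool" where
  "corson _ \<kappa> \<longleftrightarrow>
     (\<exists>G::'a set. generates_algebra G \<and> (\<forall>p\<in>Ult. |G \<inter> p| <o \<kappa>))"

text \<open>Regular cardinals are infinite by convention; the library's \<open>regularCard\<close> also holds of
  every finite cardinal order.\<close>

definition regular_cardinal :: "'k rel \<Rightarrow> bool" where
  "regular_cardinal \<kappa> \<longleftrightarrow> Card_order \<kappa> \<and> infinite (Field \<kappa>) \<and> regularCard \<kappa>"


section \<open>Compact zero-dimensional semilattices\<close>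

locale compact_zero_dim_semilattice =
  fixes X :: "'x topology" and meet :: "'x \<Rightarrow> 'x \<Rightarrow> 'x" and zero :: 'x
  assumes meet_closed: "\<lbrakk>x \<in> topspace X; y \<in> topspace X\<rbrakk> \<Longrightarrow> meet x y \<in> topspace X"
    and meet_assoc: "\<lbrakk>x \<in> topspace X; y \<in> topspace X; z \<in> topspace X\<rbrakk>
          \<Longrightarrow> meet (meet x y) z = meet x (meet y z)"
    and meet_commute: "\<lbrakk>x \<in> topspace X; y \<in> topspace X\<rbrakk> \<Longrightarrow> meet x y = meet y x"
    and meet_idem: "x \<in> topspace X \<Longrightarrow> meet x x = x"
    and zero_in: "zero \<in> topspace X"
    and zero_least: "x \<in> topspace X \<Longrightarrow> meet zero x = zero"
    and compact: "compact_space X"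
    and Hausdorff: "Hausdorff_space X"
    and zero_dimensional: "X dim_le 0"
    and meet_continuous: "continuous_map (prod_topology X X) X (\<lambda>(x, y). meet x y)"

definition meet_le :: "('x \<Rightarrow> 'x \<Rightarrow> 'x) \<Rightarrow> 'x \<Rightarrow> 'x \<Rightarrow> bool" where
  "meet_le meet x y \<longleftrightarrow> meet x y = x"

definition meet_less :: "('x \<Rightarrow> 'x \<Rightarrow> 'x) \<Rightarrow> 'x \<Rightarrow> 'x \<Rightarrow> bool" where
  "meet_less meet x y \<longleftrightarrow> meet_le meet x y \<and> x \<noteq> y"

definition is_sup :: "'x set \<Rightarrow> ('x \<Rightarrow> 'x \<Rightarrow> 'x) \<Rightarrow> 'x set \<Rightarrow> 'x \<Rightarrow> bool" where
  "is_sup L meet S a \<longleftrightarrow>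
     a \<in> L \<and> (\<forall>s\<in>S. meet_le meet s a) \<and>
     (\<forall>b\<in>L. (\<forall>s\<in>S. meet_le meet s b) \<longrightarrow> meet_le meet a b)"

definition compact_element :: "'x set \<Rightarrow> ('x \<Rightarrow> 'x \<Rightarrow> 'x) \<Rightarrow> 'x \<Rightarrow> 'x \<Rightarrow> bool" where
  "compact_element L meet zero a \<longleftrightarrow>
     a \<in> L \<and> meet_less meet zero a \<and>
     (\<forall>S\<subseteq>L. is_sup L meet S a \<longrightarrow> (\<exists>F\<subseteq>S. finite F \<and> is_sup L meet F a))"

definition immediate_predecessors :: "'x set \<Rightarrow> ('x \<Rightarrow> 'x \<Rightarrow> 'x) \<Rightarrow> 'x \<Rightarrow> 'x set" where
  "immediate_predecessors L meet a =
     {x \<in> L. meet_less meet x a \<and> (\<nexists>y. y \<in> L \<and> meet_less meet x y \<and> meet_less meet y a)}"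

definition maximal_elements :: "'x set \<Rightarrow> ('x \<Rightarrow> 'x \<Rightarrow> 'x) \<Rightarrow> 'x set" where
  "maximal_elements L meet = {x \<in> L. \<nexists>y. y \<in> L \<and> meet_less meet x y}"

locale modest_semilattice = compact_zero_dim_semilattice +
  assumes modest: "compact_element (topspace X) meet zero a
    \<Longrightarrow> finite (immediate_predecessors (topspace X) meet a)"

definition dense_subset_of :: "'x topology \<Rightarrow> 'x set \<Rightarrow> bool" where
  "dense_subset_of X D \<longleftrightarrow> D \<subseteq> topspace X \<and> X closure_of D = topspace X"

end

theory Submission
  imports Defs
begin

text \<open>Call \<open>t\<close> open if its principal up-set is open. Following Numakura, the least element of a
  clopen subsemilattice is open, so the open elements separate points and, by compactness, there are
  as many of them as there are elements of the algebra. Each lies below a member of the small dense set, so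
  by pigeonhole some maximal \<open>d\<close> has \<open>\<kappa>\<close> open elements below it. Their up-sets form a closed discrete
  set: a clopen \<open>U\<close> either fails to be a filter below \<open>d\<close>, which is witnessed by at most three points,
  or agrees below \<open>d\<close> with the up-set of an open element \<open>b\<close>, and then the point \<open>b\<close> together with the
  finitely many immediate predecessors of \<open>b\<close> isolates it.

  If all traces of a generating set on ultrafilters were small, a Delta-system argument on the supports
  would make many members of any large set converge pointwise, so no large set would be closed
  and discrete.\<close>

section \<open>Compact zero-dimensional semilattices\<close>

text \<open>Directedness puts one nonempty member inside any finite subfamily, which gives the
  finite intersection property.\<close>

lemma compact_space_directed_Inter:
  assumes "compact_space X" "C \<noteq> {}"
    and closed: "\<And>c. c \<in> C \<Longrightarrow> closedin X (A c)"
    and ne: "\<And>c. c \<in> C \<Longrightarrow> A c \<noteq> {}"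
    and dir: "\<And>c d. c \<in> C \<Longrightarrow> d \<in> C \<Longrightarrow> \<exists>e\<in>C. A e \<subseteq> A c \<and> A e \<subseteq> A d"
  obtains u where "\<And>c. c \<in> C \<Longrightarrow> u \<in> A c"
proof -
  have lb: "\<exists>e\<in>C. \<forall>c\<in>F. A e \<subseteq> A c" if "finite F" "F \<subseteq> C" for F
    using that
  proof (induction F)
    case empty
    then show ?case using \<open>C \<noteq> {}\<close> by auto
  next
    case (insert c F)
    then obtain e where "e \<in> C" "\<forall>c\<in>F. A e \<subseteq> A c" by auto
    moreover obtain e' where "e' \<in> C" "A e' \<subseteq> A c" "A e' \<subseteq> A e"
      using dir[of c e] insert.prems \<open>e \<in> C\<close> by auto
    ultimately show ?case by (metis insert_iff subset_trans)
  qed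
  have "\<Inter>\<F> \<noteq> {}" if "finite \<F>" "\<F> \<subseteq> A ` C" for \<F>
  proof -
    obtain F where "finite F" "F \<subseteq> C" "\<F> = A ` F"
      using finite_subset_image[OF \<open>finite \<F>\<close> \<open>\<F> \<subseteq> A ` C\<close>] by auto
    moreover then obtain e where "e \<in> C" "\<forall>c\<in>F. A e \<subseteq> A c"
      using lb by meson
    ultimately show ?thesis using ne[of e] by fast
  qed
  then have "\<Inter>(A ` C) \<noteq> {}"
    using \<open>compact_space X\<close>[unfolded compact_space_fip, rule_format, of "A ` C"] closed
    by auto
  then show thesis using that by auto
qed

text \<open>Compactness is used twice: on the complement of \<open>U\<close>, to fit a finite
  intersection around each point of \<open>U\<close>, and on \<open>U\<close>, to keep finitely many
  of these. The conclusion is shaped for counting clopen sets. Since \<open>sep\<close> treats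
  ordered pairs, no complements occur in it; the factor \<open>topspace X\<close> takes care of
  \<open>E = {}\<close>.\<close>

lemma clopen_in_boolean_closure:
  assumes "compact_space X"
    and clopen: "\<And>F. F \<in> \<F> \<Longrightarrow> openin X F \<and> closedin X F"
    and sep: "\<And>p q. p \<in> topspace X \<Longrightarrow> q \<in> topspace X \<Longrightarrow> p \<noteq> q \<Longrightarrow> \<exists>F\<in>\<F>. p \<in> F \<and> q \<notin> F"
    and U: "openin X U" "closedin X U"
  shows "\<exists>\<E>\<in>Fpow (Fpow \<F>). U = (\<Union>E\<in>\<E>. topspace X \<inter> \<Inter>E)"
proof -
  have "\<exists>E\<in>Fpow \<F>. p \<in> topspace X \<inter> \<Inter>E \<and> topspace X \<inter> \<Inter>E \<subseteq> U" if "p \<in> U" for p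
  proof -
    have p: "p \<in> topspace X" using that U openin_subset by blast
    \<comment> \<open>By \<open>sep\<close>, the complements of the members of \<open>\<G>\<close>
      cover everything outside \<open>U\<close>.\<close>
    define \<G> where "\<G> = {F \<in> \<F>. p \<in> F}"
    have "compactin X (topspace X - U)"
      using assms(1) U(1) closedin_compact_space by blast
    moreover have "\<forall>G\<in>(\<lambda>F. topspace X - F) ` \<G>. openin X G"
      using clopen by (auto simp: \<G>_def openin_diff)
    moreover have "topspace X - U \<subseteq> \<Union>((\<lambda>F. topspace X - F) ` \<G>)"
      using sep[OF p] that by (fastforce simp: \<G>_def)
    ultimately obtain \<H> where "finite \<H>" "\<H> \<subseteq> (\<lambda>F. topspace X - F) ` \<G>" "topspace X - U \<subseteq> \<Union>\<H>"
      unfolding compactin_def by meson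
    moreover then obtain E where "E \<subseteq> \<G>" "finite E" "\<H> = (\<lambda>F. topspace X - F) ` E"
      using finite_subset_image by metis
    ultimately show ?thesis
      using p by (intro bexI[of _ E]) (auto simp: Fpow_def \<G>_def)
  qed
  then obtain E where E: "\<And>p. p \<in> U \<Longrightarrow> E p \<in> Fpow \<F>"
    "\<And>p. p \<in> U \<Longrightarrow> p \<in> topspace X \<inter> \<Inter>(E p)" "\<And>p. p \<in> U \<Longrightarrow> topspace X \<inter> \<Inter>(E p) \<subseteq> U"
    by metis
  have "openin X (topspace X \<inter> \<Inter>(E p))" if "p \<in> U" for p
  proof -
    have "openin X (\<Inter>(insert (topspace X) (E p)))"
      using E(1)[OF that] clopen by (intro openin_Inter) (auto simp: Fpow_def)
    then show ?thesis by simp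
  qed
  then have "\<forall>V\<in>(\<lambda>p. topspace X \<inter> \<Inter>(E p)) ` U. openin X V" by blast
  moreover have "U \<subseteq> \<Union>((\<lambda>p. topspace X \<inter> \<Inter>(E p)) ` U)" using E(2) by blast
  moreover have "compactin X U"
    using assms(1) U(2) closedin_compact_space by blast
  ultimately obtain \<H> where "finite \<H>" "\<H> \<subseteq> (\<lambda>p. topspace X \<inter> \<Inter>(E p)) ` U" "U \<subseteq> \<Union>\<H>"
    unfolding compactin_def by meson
  moreover then obtain P where "P \<subseteq> U" "finite P" "\<H> = (\<lambda>p. topspace X \<inter> \<Inter>(E p)) ` P"
    using finite_subset_image by metis
  ultimately have "U \<subseteq> (\<Union>p\<in>P. topspace X \<inter> \<Inter>(E p))" by simp
  moreover have "(\<Union>p\<in>P. topspace X \<inter> \<Inter>(E p)) \<subseteq> U"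
    using E(3) \<open>P \<subseteq> U\<close> by (intro UN_least) blast
  ultimately have "U = (\<Union>F\<in>E ` P. topspace X \<inter> \<Inter>F)" by auto
  moreover have "E ` P \<in> Fpow (Fpow \<F>)"
    using \<open>P \<subseteq> U\<close> \<open>finite P\<close> E(1) by (auto simp: Fpow_def)
  ultimately show ?thesis by blast
qed

section \<open>Order-theoretic consequences of compactness\<close>

context compact_zero_dim_semilattice
begin

abbreviation L where "L \<equiv> topspace X"

abbreviation le (infix \<open>\<sqsubseteq>\<close> 50) where "x \<sqsubseteq> y \<equiv> meet_le meet x y"

lemma le_refl: "x \<in> L \<Longrightarrow> x \<sqsubseteq> x"
  by (simp add: meet_le_def meet_idem)

lemma le_trans: "x \<in> L \<Longrightarrow> y \<in> L \<Longrightarrow> z \<in> L \<Longrightarrow> x \<sqsubseteq> y \<Longrightarrow> y \<sqsubseteq> z \<Longrightarrow> x \<sqsubseteq> z"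
  unfolding meet_le_def by (metis meet_assoc)

lemma le_antisym: "x \<in> L \<Longrightarrow> y \<in> L \<Longrightarrow> x \<sqsubseteq> y \<Longrightarrow> y \<sqsubseteq> x \<Longrightarrow> x = y"
  unfolding meet_le_def by (metis meet_commute)

lemma meet_lower: "x \<in> L \<Longrightarrow> y \<in> L \<Longrightarrow> meet x y \<sqsubseteq> x" "x \<in> L \<Longrightarrow> y \<in> L \<Longrightarrow> meet x y \<sqsubseteq> y"
  unfolding meet_le_def by (metis meet_assoc meet_closed meet_commute meet_idem)+

lemma le_meet_iff:
  assumes "x \<in> L" "y \<in> L" "z \<in> L"
  shows "z \<sqsubseteq> meet x y \<longleftrightarrow> z \<sqsubseteq> x \<and> z \<sqsubseteq> y"
proof
  assume "z \<sqsubseteq> meet x y"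
  then show "z \<sqsubseteq> x \<and> z \<sqsubseteq> y"
    using assms le_trans[of z "meet x y" x] le_trans[of z "meet x y" y] by (simp add: meet_lower meet_closed)
next
  assume "z \<sqsubseteq> x \<and> z \<sqsubseteq> y"
  then show "z \<sqsubseteq> meet x y"
    using assms by (simp add: meet_le_def flip: meet_assoc)
qed

lemma zero_le: "x \<in> L \<Longrightarrow> zero \<sqsubseteq> x"
  by (simp add: meet_le_def zero_least)

lemma continuous_map_meet:
  "continuous_map X X f \<Longrightarrow> continuous_map X X g \<Longrightarrow> continuous_map X X (\<lambda>u. meet (f u) (g u))"
  using continuous_map_compose[OF continuous_map_pairedI meet_continuous] by (simp add: o_def)

lemma continuous_map_meet_const: "x \<in> L \<Longrightarrow> continuous_map X X (\<lambda>u. meet u x)"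
  by (rule continuous_map_meet) (simp_all add: continuous_map_id[unfolded id_def])

lemma closedin_ge: "t \<in> L \<Longrightarrow> closedin X {u \<in> L. t \<sqsubseteq> u}"
  unfolding meet_le_def
  by (intro closedin_continuous_maps_eq[OF Hausdorff] continuous_map_meet)
    (simp_all add: continuous_map_id[unfolded id_def])

lemma closedin_le: "t \<in> L \<Longrightarrow> closedin X {u \<in> L. u \<sqsubseteq> t}"
  unfolding meet_le_def
  by (intro closedin_continuous_maps_eq[OF Hausdorff] continuous_map_meet)
    (simp_all add: continuous_map_id[unfolded id_def])

text \<open>Principal up-sets are closed, so their traces on \<open>M\<close> form a directed family
  of nonempty closed sets; a common point is the bound. That it lies in \<open>M\<close> again is
  what later arguments exploit.\<close>

lemma directed_upper_bound:
  assumes "closedin X M" "C \<subseteq> M" "C \<noteq> {}"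
    and dir: "\<And>c d. c \<in> C \<Longrightarrow> d \<in> C \<Longrightarrow> \<exists>e\<in>C. c \<sqsubseteq> e \<and> d \<sqsubseteq> e"
  shows "\<exists>u\<in>M. \<forall>c\<in>C. c \<sqsubseteq> u"
proof -
  have M: "M \<subseteq> L" using assms(1) closedin_subset by blast
  have eq: "{u \<in> M. c \<sqsubseteq> u} = M \<inter> {u \<in> L. c \<sqsubseteq> u}" for c using M by auto
  obtain u where "\<And>c. c \<in> C \<Longrightarrow> u \<in> {u \<in> M. c \<sqsubseteq> u}"
  proof (rule compact_space_directed_Inter[OF compact \<open>C \<noteq> {}\<close>, of "\<lambda>c. {u \<in> M. c \<sqsubseteq> u}"])
    show "closedin X {u \<in> M. c \<sqsubseteq> u}" if "c \<in> C" for c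
      unfolding eq using that assms(1,2) M by (intro closedin_Int closedin_ge) auto
    show "{u \<in> M. c \<sqsubseteq> u} \<noteq> {}" if "c \<in> C" for c
      using that assms(2) M le_refl by blast
    show "\<exists>e\<in>C. {u \<in> M. e \<sqsubseteq> u} \<subseteq> {u \<in> M. c \<sqsubseteq> u} \<and> {u \<in> M. e \<sqsubseteq> u} \<subseteq> {u \<in> M. d \<sqsubseteq> u}"
      if cd: "c \<in> C" "d \<in> C" for c d
    proof -
      obtain e where e: "e \<in> C" "c \<sqsubseteq> e" "d \<sqsubseteq> e" using dir[OF cd] by blast
      moreover have "c \<in> L" "d \<in> L" "e \<in> L" using cd e assms(2) M by auto
      ultimately have "{u \<in> M. e \<sqsubseteq> u} \<subseteq> {u \<in> M. c \<sqsubseteq> u}" "{u \<in> M. e \<sqsubseteq> u} \<subseteq> {u \<in> M. d \<sqsubseteq> u}"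
        using M le_trans[of c e] le_trans[of d e] by auto
      then show ?thesis using e by blast
    qed
  qed blast
  then show ?thesis using \<open>C \<noteq> {}\<close> by blast
qed

text \<open>The traces of the principal down-sets are closed and directed, because
  \<open>meet c d\<close> refines both \<open>c\<close> and \<open>d\<close>; a common point is the
  least element.\<close>

lemma closed_subsemilattice_least:
  assumes "closedin X T" "T \<noteq> {}" and meet: "\<And>x y. x \<in> T \<Longrightarrow> y \<in> T \<Longrightarrow> meet x y \<in> T"
  shows "\<exists>m\<in>T. \<forall>u\<in>T. m \<sqsubseteq> u"
proof -
  have T: "T \<subseteq> L" using assms(1) closedin_subset by blast
  have eq: "{u \<in> T. u \<sqsubseteq> c} = T \<inter> {u \<in> L. u \<sqsubseteq> c}" for c using T by auto
  obtain u where "\<And>c. c \<in> T \<Longrightarrow> u \<in> {u \<in> T. u \<sqsubseteq> c}"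
  proof (rule compact_space_directed_Inter[OF compact \<open>T \<noteq> {}\<close>, of "\<lambda>c. {u \<in> T. u \<sqsubseteq> c}"])
    show "closedin X {u \<in> T. u \<sqsubseteq> c}" if "c \<in> T" for c
      unfolding eq using that assms(1) T by (intro closedin_Int closedin_le) auto
    show "{u \<in> T. u \<sqsubseteq> c} \<noteq> {}" if "c \<in> T" for c
      using that T le_refl by blast
    show "\<exists>e\<in>T. {u \<in> T. u \<sqsubseteq> e} \<subseteq> {u \<in> T. u \<sqsubseteq> c} \<and> {u \<in> T. u \<sqsubseteq> e} \<subseteq> {u \<in> T. u \<sqsubseteq> d}"
      if "c \<in> T" "d \<in> T" for c d
    proof (intro bexI[of _ "meet c d"] conjI subsetI)
      fix u assume "u \<in> {u \<in> T. u \<sqsubseteq> meet c d}"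
      then show "u \<in> {u \<in> T. u \<sqsubseteq> c}" "u \<in> {u \<in> T. u \<sqsubseteq> d}"
        using that T le_meet_iff[of c d u] by auto
    qed (use that meet in blast)
  qed blast
  then show ?thesis using \<open>T \<noteq> {}\<close> by blast
qed

text \<open>Zorn's lemma, with chains bounded by compactness. It is applied to the whole space, to
  reach maximal elements, and to the elements strictly below a point, to reach immediate
  predecessors.\<close>

lemma maximal_above:
  assumes "closedin X M" "x \<in> M"
  obtains m where "m \<in> M" "x \<sqsubseteq> m" "\<And>y. y \<in> M \<Longrightarrow> m \<sqsubseteq> y \<Longrightarrow> y = m"
proof -
  have M: "M \<subseteq> L" using assms(1) closedin_subset by blast
  define A where "A = {y \<in> M. x \<sqsubseteq> y}"
  have A: "A \<subseteq> L" "x \<in> A" using M assms(2) le_refl by (auto simp: A_def)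
  have "A = M \<inter> {u \<in> L. x \<sqsubseteq> u}" using M by (auto simp: A_def)
  then have closed: "closedin X A"
    using assms M by (auto intro!: closedin_Int closedin_ge)
  have "\<exists>m\<in>A. \<forall>y\<in>A. m \<sqsubseteq> y \<longrightarrow> y = m"
  proof (rule predicate_Zorn)
    show "partial_order_on A (relation_of (\<sqsubseteq>) A)"
    proof (rule partial_order_on_relation_ofI)
      show "a \<sqsubseteq> a" if "a \<in> A" for a using that A le_refl by blast
      show "a \<sqsubseteq> c" if "a \<in> A" "b \<in> A" "c \<in> A" "a \<sqsubseteq> b" "b \<sqsubseteq> c" for a b c
        using that A le_trans[of a b c] by blast
      show "a = b" if "a \<in> A" "b \<in> A" "a \<sqsubseteq> b" "b \<sqsubseteq> a" for a b
        using that A le_antisym[of a b] by blast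
    qed
    show "\<exists>u\<in>A. \<forall>c\<in>C. c \<sqsubseteq> u" if C: "C \<in> Chains (relation_of (\<sqsubseteq>) A)" for C
    proof (cases "C = {}")
      case False
      have "C \<subseteq> A" using C by (auto simp: Chains_def relation_of_def)
      moreover have "\<exists>e\<in>C. c \<sqsubseteq> e \<and> d \<sqsubseteq> e" if "c \<in> C" "d \<in> C" for c d
      proof -
        have "c \<sqsubseteq> d \<or> d \<sqsubseteq> c" using that C by (auto simp: Chains_def relation_of_def)
        moreover have "c \<sqsubseteq> c" "d \<sqsubseteq> d" using that A \<open>C \<subseteq> A\<close> le_refl by auto
        ultimately show ?thesis using that by blast
      qed
      ultimately show ?thesis using directed_upper_bound[OF closed] False by blast
    qed (use A in auto)
  qed
  then obtain m where m: "m \<in> A" "\<And>y. y \<in> A \<Longrightarrow> m \<sqsubseteq> y \<Longrightarrow> y = m" by blast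
  moreover have "y \<in> A" if "y \<in> M" "m \<sqsubseteq> y" for y
    using that m(1) A M le_trans[of x m y] by (auto simp: A_def)
  ultimately show thesis using that by (auto simp: A_def)
qed

text \<open>The upper bounds of \<open>F\<close> form a closed subsemilattice, nonempty because of
  \<open>b\<close>, and its least element is the supremum.\<close>

lemma ex_sup:
  assumes "F \<subseteq> L" "b \<in> L" "\<forall>f\<in>F. f \<sqsubseteq> b"
  shows "\<exists>s. is_sup L meet F s"
proof -
  define T where "T = {u \<in> L. \<forall>f\<in>F. f \<sqsubseteq> u}"
  have T: "T = \<Inter>(insert L ((\<lambda>f. {u \<in> L. f \<sqsubseteq> u}) ` F))"
    by (auto simp: T_def)
  have "closedin X T"
    unfolding T by (rule closedin_Inter) (use assms(1) closedin_ge in auto)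
  moreover have "meet x y \<in> T" if "x \<in> T" "y \<in> T" for x y
    using that assms(1) by (auto simp: T_def meet_closed le_meet_iff subset_iff)
  ultimately obtain m where "m \<in> T" "\<forall>u\<in>T. m \<sqsubseteq> u"
    using closed_subsemilattice_least[of T] assms by (auto simp: T_def)
  then show ?thesis by (auto simp: is_sup_def T_def)
qed

text \<open>This makes the hypothesis \<open>modest\<close> applicable to open elements. If no
  finite part of \<open>S\<close> had supremum \<open>t\<close>, the finite suprema would form a
  directed set in the closed complement of the up-set of \<open>t\<close>; a bound inside that
  complement would still bound \<open>S\<close>, hence lie above \<open>t\<close>.\<close>

lemma openin_ge_imp_compact_element:
  assumes t: "t \<in> L" "openin X {u \<in> L. t \<sqsubseteq> u}" "t \<noteq> zero"
  shows "compact_element L meet zero t"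
proof -
  have "\<exists>F\<subseteq>S. finite F \<and> is_sup L meet F t" if "S \<subseteq> L" and S: "is_sup L meet S t" for S
  proof (rule ccontr)
    assume contra: "\<not> ?thesis"
    \<comment> \<open>\<open>C\<close> collects the finite suprema, and \<open>M\<close> is the
      closed set that must contain them.\<close>
    define C where "C = {s. \<exists>F\<subseteq>S. finite F \<and> is_sup L meet F s}"
    define M where "M = L - {u \<in> L. t \<sqsubseteq> u}"
    have sup: "\<exists>s. is_sup L meet F s" if "F \<subseteq> S" for F
      using that S \<open>S \<subseteq> L\<close> by (intro ex_sup[of F t]) (auto simp: is_sup_def)
    have "s \<in> M" if s: "s \<in> C" for s
    proof -
      obtain F where F: "F \<subseteq> S" "finite F" "is_sup L meet F s"
        using s by (auto simp: C_def)
      then have "s \<sqsubseteq> t" "s \<in> L" using S by (auto simp: is_sup_def subset_iff)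
      moreover have "s \<noteq> t" using F contra by blast
      ultimately show ?thesis using t le_antisym by (auto simp: M_def)
    qed
    moreover have "\<exists>e\<in>C. c \<sqsubseteq> e \<and> d \<sqsubseteq> e" if cd: "c \<in> C" "d \<in> C" for c d
    proof -
      obtain F G where FG: "F \<subseteq> S" "finite F" "is_sup L meet F c" "G \<subseteq> S" "finite G" "is_sup L meet G d"
        using cd by (auto simp: C_def)
      then have *: "F \<union> G \<subseteq> S" "finite (F \<union> G)" by auto
      then obtain e where e: "is_sup L meet (F \<union> G) e" using sup[of "F \<union> G"] by blast
      then have "e \<in> C" using * unfolding C_def by blast
      then show ?thesis using e FG(3,6) unfolding is_sup_def by blast
    qed
    moreover have "C \<noteq> {}" using sup[of "{}"] by (auto simp: C_def)
    moreover have "closedin X M" using t by (auto simp: M_def)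
    ultimately obtain u where u: "u \<in> M" "\<forall>c\<in>C. c \<sqsubseteq> u"
      using directed_upper_bound[of M C] by blast
    have "s \<in> C" if "s \<in> S" for s
    proof -
      have "is_sup L meet {s} s" using that \<open>S \<subseteq> L\<close> le_refl by (auto simp: is_sup_def)
      then show ?thesis using that unfolding C_def by blast
    qed
    then have "t \<sqsubseteq> u" using S u by (auto simp: is_sup_def M_def)
    then show False using u by (auto simp: M_def)
  qed
  then show ?thesis
    using t zero_le by (auto simp: compact_element_def meet_less_def)
qed

text \<open>Unlike the compact elements, \<open>open_elements\<close> always contains \<open>zero\<close>.\<close>

definition open_elements where "open_elements = {t \<in> L. openin X {u \<in> L. t \<sqsubseteq> u}}"

section \<open>Open elements\<close>

text \<open>Openness rests on projection along a compact factor being a closed map; closedness holds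
  because the set is an intersection of preimages under translations. The stabilizer is the source
  of clopen subsemilattices.\<close>

lemma openin_translation_stabilizer:
  assumes U: "openin X U" "closedin X U"
  shows "openin X {u \<in> L. \<forall>v\<in>U. meet u v \<in> U}" "closedin X {u \<in> L. \<forall>v\<in>U. meet u v \<in> U}"
proof -
  let ?T = "{u \<in> L. \<forall>v\<in>U. meet u v \<in> U}"
  have "U \<subseteq> L" using U openin_subset by blast
  \<comment> \<open>The pairs that violate stability; their first coordinates are the complement of
    \<open>?T\<close>.\<close>
  define E where "E = {z \<in> L \<times> L. snd z \<in> U} \<inter> {z \<in> L \<times> L. case_prod meet z \<in> L - U}"
  have "closedin (prod_topology X X) {z \<in> topspace (prod_topology X X). snd z \<in> U}"
    using U(2) by (intro closedin_continuous_map_preimage[OF continuous_map_snd])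
  moreover have "closedin (prod_topology X X) {z \<in> topspace (prod_topology X X). case_prod meet z \<in> L - U}"
    using U(1) by (intro closedin_continuous_map_preimage[OF meet_continuous]) auto
  ultimately have "closedin (prod_topology X X) E"
    unfolding E_def topspace_prod_topology by (rule closedin_Int)
  then have "closedin X (fst ` E)"
    using closed_map_fst[OF compact] by (auto simp: closed_map_def)
  moreover have "u \<in> fst ` E \<longleftrightarrow> (\<exists>v\<in>U. meet u v \<notin> U)" if "u \<in> L" for u
  proof -
    have "(u, v) \<in> E \<longleftrightarrow> v \<in> U \<and> meet u v \<notin> U" for v
      using that \<open>U \<subseteq> L\<close> meet_closed[of u v] by (auto simp: E_def)
    then show ?thesis by (force simp: image_iff)
  qed
  then have "?T = L - fst ` E" by auto
  ultimately show "openin X ?T" by (simp add: openin_diff)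
  have "?T = \<Inter>(insert L ((\<lambda>v. {u \<in> L. meet u v \<in> U}) ` U))" by auto
  also have "closedin X \<dots>"
  proof (rule closedin_Inter)
    fix S assume "S \<in> insert L ((\<lambda>v. {u \<in> L. meet u v \<in> U}) ` U)"
    then show "closedin X S"
      using closedin_continuous_map_preimage[OF continuous_map_meet_const U(2)] \<open>U \<subseteq> L\<close> by auto
  qed simp
  finally show "closedin X ?T" .
qed

text \<open>A clopen subsemilattice \<open>T\<close> containing \<open>x\<close> is built so that
  its least element \<open>t\<close> lies in a clopen neighbourhood \<open>U\<close> of
  \<open>x\<close> that misses the down-set of \<open>y\<close>.\<close>

lemma open_elements_separate:
  assumes "x \<in> L" "y \<in> L" "\<not> x \<sqsubseteq> y"
  obtains t where "t \<in> open_elements" "t \<sqsubseteq> x" "\<not> t \<sqsubseteq> y"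
proof -
  have "openin X (L - {u \<in> L. u \<sqsubseteq> y})" "x \<in> L - {u \<in> L. u \<sqsubseteq> y}"
    using assms closedin_le by auto
  then obtain V U where U: "openin X U" "closedin X U" "x \<in> U" "U \<subseteq> L - {u \<in> L. u \<sqsubseteq> y}"
    using zero_dimensional
    unfolding dimension_le_0_neighbourhood_base_of_clopen neighbourhood_base_of by (meson subsetD)
  \<comment> \<open>Membership in \<open>W\<close> depends only on \<open>meet u x\<close>. This
    places \<open>x\<close> in the stabilizer \<open>T\<close> of \<open>W\<close>, and
    \<open>T\<close> inside \<open>W\<close>.\<close>
  define W where "W = {u \<in> L. meet u x \<in> U}"
  have W: "openin X W" "closedin X W" "W \<subseteq> L"
    unfolding W_def using U(1,2) continuous_map_meet_const[OF assms(1)]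
    by (auto intro: openin_continuous_map_preimage closedin_continuous_map_preimage)
  define T where "T = {u \<in> L. \<forall>v\<in>W. meet u v \<in> W}"
  have T: "openin X T" "closedin X T"
    unfolding T_def using openin_translation_stabilizer W by auto
  have absorb: "meet (meet u x) x = meet u x" if "u \<in> L" for u
    using that assms(1) by (simp add: meet_assoc meet_idem)
  have "x \<in> W" using assms U by (simp add: W_def meet_idem)
  have "x \<in> T"
    using assms(1) W(3) by (auto simp: T_def W_def meet_commute[of x] meet_closed absorb)
  have TW: "T \<subseteq> W"
  proof
    fix u assume "u \<in> T"
    then have "u \<in> L" "meet u x \<in> W" using \<open>x \<in> W\<close> by (auto simp: T_def)
    then show "u \<in> W" using absorb by (simp add: W_def)
  qed
  have Tmeet: "meet u v \<in> T" if "u \<in> T" "v \<in> T" for u v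
    using that W(3) by (auto simp: T_def meet_closed meet_assoc subset_iff)
  obtain t where t: "t \<in> T" "\<And>u. u \<in> T \<Longrightarrow> t \<sqsubseteq> u"
    using closed_subsemilattice_least[OF T(2)] Tmeet \<open>x \<in> T\<close> by blast
  then have "t \<in> L" by (auto simp: T_def)
  have "t \<sqsubseteq> x" using t \<open>x \<in> T\<close> by blast
  then have "t \<in> U" using t TW by (auto simp: W_def meet_le_def)
  \<comment> \<open>As \<open>t\<close> is least in \<open>T\<close>, its up-set is the preimage of
    the open set \<open>T\<close> under translation by \<open>t\<close>, hence open.\<close>
  have "t \<sqsubseteq> u \<longleftrightarrow> meet u t \<in> T" if "u \<in> L" for u
  proof
    show "t \<sqsubseteq> u \<Longrightarrow> meet u t \<in> T"
      using t(1) that \<open>t \<in> L\<close> by (simp add: meet_le_def meet_commute)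
    show "meet u t \<in> T \<Longrightarrow> t \<sqsubseteq> u"
      using t(2) that \<open>t \<in> L\<close> le_meet_iff by blast
  qed
  then have "{u \<in> L. t \<sqsubseteq> u} = {u \<in> L. meet u t \<in> T}" by blast
  then have "t \<in> open_elements"
    using openin_continuous_map_preimage[OF continuous_map_meet_const[OF \<open>t \<in> L\<close>] T(1)] \<open>t \<in> L\<close>
    by (simp add: open_elements_def)
  then show thesis
    using that \<open>t \<sqsubseteq> x\<close> \<open>t \<in> U\<close> U(4) \<open>t \<in> L\<close> by blast
qed

text \<open>The trace of \<open>U\<close> below \<open>d\<close> is a clopen filter; its least element is open in the whole
  semilattice because \<open>u \<mapsto> u \<and> d\<close> is continuous.\<close>

lemma open_element_of_filter_trace:
  assumes d: "d \<in> L" and U: "openin X U" "closedin X U" "d \<in> U"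
    and up: "\<And>x y. x \<in> U \<Longrightarrow> y \<in> L \<Longrightarrow> x \<sqsubseteq> y \<Longrightarrow> y \<sqsubseteq> d \<Longrightarrow> y \<in> U"
    and meet: "\<And>x y. x \<in> U \<Longrightarrow> y \<in> U \<Longrightarrow> x \<sqsubseteq> d \<Longrightarrow> y \<sqsubseteq> d \<Longrightarrow> meet x y \<in> U"
  shows "\<exists>b\<in>open_elements. b \<sqsubseteq> d \<and> (\<forall>x\<in>L. x \<sqsubseteq> d \<longrightarrow> (x \<in> U \<longleftrightarrow> b \<sqsubseteq> x))"
proof -
  have UL: "U \<subseteq> L" using U openin_subset by blast
  define T where "T = U \<inter> {u \<in> L. u \<sqsubseteq> d}"
  have "closedin X T" unfolding T_def using U d closedin_le by blast
  moreover have "d \<in> T" using d U le_refl by (simp add: T_def)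
  moreover have "meet x y \<in> T" if "x \<in> T" "y \<in> T" for x y
    using that meet[of x y] d le_trans[of "meet x y" x d] meet_closed meet_lower(1)
    by (auto simp: T_def)
  ultimately obtain b where b: "b \<in> T" "\<And>u. u \<in> T \<Longrightarrow> b \<sqsubseteq> u"
    using closed_subsemilattice_least[of T] by blast
  then have bL: "b \<in> L" "b \<in> U" "b \<sqsubseteq> d" by (auto simp: T_def)
  have eq: "x \<in> U \<longleftrightarrow> b \<sqsubseteq> x" if "x \<in> L" "x \<sqsubseteq> d" for x
    using that b(2)[of x] up[OF bL(2)] by (auto simp: T_def)
  \<comment> \<open>Because \<open>b\<close> is below \<open>d\<close>, it is below \<open>u\<close>
    exactly if it is below \<open>meet u d\<close>, where \<open>eq\<close> applies.\<close>
  have "b \<sqsubseteq> u \<longleftrightarrow> meet u d \<in> U" if "u \<in> L" for u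
    using that d bL eq[of "meet u d"] meet_closed meet_lower(2) le_meet_iff by blast
  then have "{u \<in> L. b \<sqsubseteq> u} = {u \<in> L. meet u d \<in> U}" by blast
  then have "b \<in> open_elements"
    using openin_continuous_map_preimage[OF continuous_map_meet_const[OF d] U(1)] bL
    by (simp add: open_elements_def)
  then show ?thesis using bL eq by blast
qed

end

section \<open>Modesty and finite determination below a point\<close>

context modest_semilattice
begin

text \<open>The elements strictly below \<open>t\<close> form a closed set because the up-set of
  \<open>t\<close> is open, so each lies below a maximal one, which is an immediate predecessor.
  Compact elements exclude \<open>zero\<close>; nothing lies strictly below it, so there
  \<open>I\<close> is empty.\<close>

lemma open_element_predecessors:
  assumes "t \<in> open_elements"
  obtains I where "finite I" "I \<subseteq> L" "\<And>c. c \<in> I \<Longrightarrow> c \<sqsubseteq> t" "\<And>c. c \<in> I \<Longrightarrow> \<not> t \<sqsubseteq> c"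
    "\<And>u. u \<in> L \<Longrightarrow> u \<sqsubseteq> t \<Longrightarrow> u \<noteq> t \<Longrightarrow> \<exists>c\<in>I. u \<sqsubseteq> c"
proof (cases "t = zero")
  case True
  show ?thesis
    by (rule that[of "{}"]) (use True zero_in zero_le le_antisym in auto)
next
  case False
  have t: "t \<in> L" "openin X {u \<in> L. t \<sqsubseteq> u}" using assms by (auto simp: open_elements_def)
  define I where "I = immediate_predecessors L meet t"
  have "finite I"
    unfolding I_def using t False by (intro modest openin_ge_imp_compact_element)
  moreover have "I \<subseteq> L" "\<And>c. c \<in> I \<Longrightarrow> c \<sqsubseteq> t" "\<And>c. c \<in> I \<Longrightarrow> \<not> t \<sqsubseteq> c"
    using t le_antisym by (auto simp: I_def immediate_predecessors_def meet_less_def)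
  moreover have "\<exists>c\<in>I. u \<sqsubseteq> c" if u: "u \<in> L" "u \<sqsubseteq> t" "u \<noteq> t" for u
  proof -
    define M where "M = {u \<in> L. u \<sqsubseteq> t} - {u \<in> L. t \<sqsubseteq> u}"
    have "closedin X M" unfolding M_def using t closedin_le by blast
    moreover have "u \<in> M" using u t le_antisym by (auto simp: M_def)
    ultimately obtain m where m: "m \<in> M" "u \<sqsubseteq> m" "\<And>y. y \<in> M \<Longrightarrow> m \<sqsubseteq> y \<Longrightarrow> y = m"
      using maximal_above by blast
    have "m \<in> I"
      unfolding I_def immediate_predecessors_def
    proof (intro CollectI conjI notI)
      show "m \<in> L" "meet_less meet m t" using m t le_refl by (auto simp: M_def meet_less_def)
      assume "\<exists>y. y \<in> L \<and> meet_less meet m y \<and> meet_less meet y t"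
      then obtain y where y: "y \<in> L" "m \<sqsubseteq> y" "m \<noteq> y" "y \<sqsubseteq> t" "y \<noteq> t"
        by (auto simp: meet_less_def)
      then have "y \<in> M" using t le_antisym by (auto simp: M_def)
      then show False using y m(3) by blast
    qed
    then show ?thesis using m by blast
  qed
  ultimately show ?thesis using that by blast
qed

text \<open>Uniqueness is stated for two elements \<open>s\<close> and \<open>t\<close>, since
  \<open>U\<close> itself need not be an up-set of this kind. In the first three cases of the proof
  no candidate agrees with \<open>U\<close> on \<open>P\<close>; in the last only \<open>b\<close>
  can.\<close>

lemma finitely_determined_below:
  assumes d: "d \<in> L" and U: "openin X U" "closedin X U"
  shows "\<exists>P\<subseteq>L. finite P \<and> (\<forall>s\<in>open_elements. \<forall>t\<in>open_elements. s \<sqsubseteq> d \<longrightarrow> t \<sqsubseteq> d \<longrightarrow>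
    (\<forall>p\<in>P. p \<in> U \<longleftrightarrow> s \<sqsubseteq> p) \<longrightarrow> (\<forall>p\<in>P. p \<in> U \<longleftrightarrow> t \<sqsubseteq> p) \<longrightarrow> s = t)"
proof -
  have UL: "U \<subseteq> L" using U openin_subset by blast
  have KL: "open_elements \<subseteq> L" by (auto simp: open_elements_def)
  consider (out) "d \<notin> U"
    | (up) x y where "x \<in> U" "y \<in> L" "x \<sqsubseteq> y" "y \<notin> U"
    | (meet) x y where "x \<in> U" "y \<in> U" "meet x y \<notin> U"
    | (filter) "d \<in> U" "\<And>x y. x \<in> U \<Longrightarrow> y \<in> L \<Longrightarrow> x \<sqsubseteq> y \<Longrightarrow> y \<sqsubseteq> d \<Longrightarrow> y \<in> U"
      "\<And>x y. x \<in> U \<Longrightarrow> y \<in> U \<Longrightarrow> x \<sqsubseteq> d \<Longrightarrow> y \<sqsubseteq> d \<Longrightarrow> meet x y \<in> U"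
    by blast
  then show ?thesis
  proof cases
    case out
    then show ?thesis using d by (intro exI[of _ "{d}"]) auto
  next
    case up
    then have "x \<in> L" using UL by blast
    have "\<not> (\<forall>p\<in>{x, y}. p \<in> U \<longleftrightarrow> t \<sqsubseteq> p)" if "t \<in> open_elements" for t
      using that KL up \<open>x \<in> L\<close> le_trans[of t x y] by auto
    then show ?thesis using up \<open>x \<in> L\<close> by (intro exI[of _ "{x, y}"]) auto
  next
    case meet
    then have xy: "x \<in> L" "y \<in> L" "meet x y \<in> L" using UL meet_closed by auto
    have "\<not> (\<forall>p\<in>{x, y, meet x y}. p \<in> U \<longleftrightarrow> t \<sqsubseteq> p)" if "t \<in> open_elements" for t
      using that KL meet xy le_meet_iff by auto
    then show ?thesis using xy by (intro exI[of _ "{x, y, meet x y}"]) auto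
  next
    case filter
    obtain b where b: "b \<in> open_elements" "b \<sqsubseteq> d" "\<And>x. x \<in> L \<Longrightarrow> x \<sqsubseteq> d \<Longrightarrow> x \<in> U \<longleftrightarrow> b \<sqsubseteq> x"
    proof -
      have "\<exists>b\<in>open_elements. b \<sqsubseteq> d \<and> (\<forall>x\<in>L. x \<sqsubseteq> d \<longrightarrow> (x \<in> U \<longleftrightarrow> b \<sqsubseteq> x))"
        by (rule open_element_of_filter_trace[OF d U filter(1)]; fact filter)
      then show thesis using that by blast
    qed
    then have bL: "b \<in> L" using KL by blast
    obtain I where I: "finite I" "I \<subseteq> L" "\<And>c. c \<in> I \<Longrightarrow> c \<sqsubseteq> b" "\<And>c. c \<in> I \<Longrightarrow> \<not> b \<sqsubseteq> c"
      "\<And>u. u \<in> L \<Longrightarrow> u \<sqsubseteq> b \<Longrightarrow> u \<noteq> b \<Longrightarrow> \<exists>c\<in>I. u \<sqsubseteq> c"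
      using open_element_predecessors[OF b(1)] by blast
    \<comment> \<open>Agreement at \<open>b\<close> gives \<open>t \<sqsubseteq> b\<close>. If
      \<open>t\<close> differs from \<open>b\<close>, it lies below some \<open>c\<close> in
      \<open>I\<close>, so agreement puts \<open>c\<close> in \<open>U\<close> and forces
      \<open>b \<sqsubseteq> c\<close>, which \<open>I\<close> rules out.\<close>
    have "t = b" if t: "t \<in> open_elements" "t \<sqsubseteq> d" "\<forall>p\<in>insert b I. p \<in> U \<longleftrightarrow> t \<sqsubseteq> p" for t
    proof (rule ccontr)
      assume "t \<noteq> b"
      have tL: "t \<in> L" using t KL by blast
      have "t \<sqsubseteq> b" using t b bL le_refl by auto
      then obtain c where c: "c \<in> I" "t \<sqsubseteq> c" using I(5) \<open>t \<noteq> b\<close> tL by blast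
      then have "c \<in> U" using t(3) by blast
      then show False using I(2-4) c b(2,3) bL d le_trans by blast
    qed
    then show ?thesis using I(1,2) bL by (intro exI[of _ "insert b I"] conjI ballI impI) blast+
  qed
qed

end

section \<open>Cardinalities\<close>

text \<open>Counting by size: the sets of size \<open>n + 1\<close> arise by inserting one of
  \<open>|A|\<close> elements into sets of size \<open>n\<close>, and there are only countably many
  sizes.\<close>

lemma card_of_Fpow_le:
  assumes "infinite A"
  shows "|Fpow A| \<le>o |A|"
proof -
  define S where "S n = {F \<in> Fpow A. card F = n}" for n
  have "|S n| \<le>o |A|" for n
  proof (induction n)
    case 0
    have "S 0 = {{}}" by (auto simp: S_def Fpow_def)
    then show ?case using assms by (metis card_of_singl_ordLeq finite.emptyI)
  next
    case (Suc n)
    have "S (Suc n) \<subseteq> (\<Union>a\<in>A. insert a ` S n)"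
    proof
      fix F assume "F \<in> S (Suc n)"
      then have F: "F \<subseteq> A" "finite F" "card F = Suc n" by (auto simp: S_def Fpow_def)
      then obtain a F' where "F = insert a F'" "a \<notin> F'" "card F' = n"
        by (auto simp: card_Suc_eq)
      with F show "F \<in> (\<Union>a\<in>A. insert a ` S n)" by (auto simp: S_def Fpow_def)
    qed
    moreover have "|\<Union>a\<in>A. insert a ` S n| \<le>o |A|"
    proof (rule card_of_UNION_ordLeq_infinite[OF assms])
      show "\<forall>a\<in>A. |insert a ` S n| \<le>o |A|"
        using Suc card_of_image ordLeq_transitive by blast
    qed (simp add: card_of_mono1)
    ultimately show ?case using card_of_mono1 ordLeq_transitive by blast
  qed
  moreover have "Fpow A \<subseteq> (\<Union>n. S n)" by (auto simp: S_def)
  moreover have "|UNIV :: nat set| \<le>o |A|"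
    using assms by (simp add: infinite_iff_card_of_nat)
  ultimately show ?thesis
    using card_of_UNION_ordLeq_infinite[OF assms, of "UNIV :: nat set" S] card_of_mono1
      ordLeq_transitive by blast
qed

lemma regular_cardinal_stable: "regular_cardinal r \<Longrightarrow> stable r"
  by (simp add: regular_cardinal_def regularCard_stable)

lemma regular_cardinal_finite_less: "regular_cardinal r \<Longrightarrow> finite A \<Longrightarrow> |A| <o r"
  unfolding regular_cardinal_def
  by (metis Field_card_of card_of_Well_order card_order_on_well_order_on finite_ordLess_infinite)

lemma regular_cardinal_Un_less:
  "regular_cardinal r \<Longrightarrow> |A| <o r \<Longrightarrow> |B| <o r \<Longrightarrow> |A \<union> B| <o r"
  by (simp add: regular_cardinal_def card_of_Un_ordLess_infinite_Field)

lemma card_of_not_less_iff: "Card_order r \<Longrightarrow> \<not> |A| <o r \<longleftrightarrow> r \<le>o |A|"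
  by (intro not_ordLess_iff_ordLeq card_of_Well_order) (simp add: card_order_on_well_order_on)

text \<open>Fewer than \<open>r\<close> fibres, each smaller than \<open>r\<close>, cannot cover
  \<open>A\<close> when \<open>r\<close> is stable.\<close>

lemma stable_pigeonhole:
  assumes "stable r" "|I| <o r" "f ` A \<subseteq> I" "\<not> |A| <o r"
  obtains i where "i \<in> I" "\<not> |{a \<in> A. f a = i}| <o r"
proof -
  have "A = (\<Union>i\<in>I. {a \<in> A. f a = i})" using assms(3) by auto
  then show thesis
    using stable_UNION[OF assms(1,2), of "\<lambda>i. {a \<in> A. f a = i}"] assms(4) that by auto
qed

section \<open>Ultrafilters and the Stone topology\<close>

lemma proper_filter_extends:
  assumes "proper_filter p"
  obtains q where "q \<in> Ult" "p \<subseteq> q"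
proof -
  have "\<exists>M\<in>{q. proper_filter q \<and> p \<subseteq> q}. \<forall>X\<in>{q. proper_filter q \<and> p \<subseteq> q}. M \<subseteq> X \<longrightarrow> X = M"
  proof (rule subset_Zorn_nonempty)
    fix \<C> assume \<C>: "\<C> \<noteq> {}" "subset.chain {q. proper_filter q \<and> p \<subseteq> q} \<C>"
    then have q: "proper_filter q" "p \<subseteq> q" if "q \<in> \<C>" for q
      using that unfolding subset_chain_def by auto
    have "inf a b \<in> \<Union>\<C>" if ab: "a \<in> \<Union>\<C>" "b \<in> \<Union>\<C>" for a b
    proof -
      obtain x y where "x \<in> \<C>" "a \<in> x" "y \<in> \<C>" "b \<in> y" using ab by blast
      moreover then have "x \<subseteq> y \<or> y \<subseteq> x" using \<C> unfolding subset_chain_def by blast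
      ultimately obtain z where "z \<in> \<C>" "a \<in> z" "b \<in> z" by blast
      then show ?thesis using q(1)[of z] by (auto simp: proper_filter_def)
    qed
    moreover have "top \<in> \<Union>\<C>" "bot \<notin> \<Union>\<C>" "\<forall>a\<in>\<Union>\<C>. \<forall>b. a \<le> b \<longrightarrow> b \<in> \<Union>\<C>" "p \<subseteq> \<Union>\<C>"
      using q \<C>(1) unfolding proper_filter_def by blast+
    ultimately show "\<Union>\<C> \<in> {q. proper_filter q \<and> p \<subseteq> q}"
      by (simp add: proper_filter_def)
  qed (use assms in auto)
  then obtain q where q: "proper_filter q" "p \<subseteq> q"
    and max: "\<forall>X\<in>{q. proper_filter q \<and> p \<subseteq> q}. q \<subseteq> X \<longrightarrow> X = q"
    by (elim bexE CollectE conjE)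
  have "X = q" if "proper_filter X" "q \<subseteq> X" for X
    using max that \<open>p \<subseteq> q\<close> by simp
  then have "q \<in> Ult" using q(1) by (simp add: Ult_def)
  then show thesis using that \<open>p \<subseteq> q\<close> by blast
qed

lemma Ult_proper_filter: "p \<in> Ult \<Longrightarrow> proper_filter p"
  by (simp add: Ult_def)

lemma Ult_top: "p \<in> Ult \<Longrightarrow> top \<in> p"
  and Ult_bot: "p \<in> Ult \<Longrightarrow> bot \<notin> p"
  by (auto dest!: Ult_proper_filter simp: proper_filter_def)

lemma Ult_mono: "p \<in> Ult \<Longrightarrow> a \<in> p \<Longrightarrow> a \<le> b \<Longrightarrow> b \<in> p"
  by (auto dest!: Ult_proper_filter simp: proper_filter_def)

lemma Ult_inf: "p \<in> Ult \<Longrightarrow> inf a b \<in> p \<longleftrightarrow> a \<in> p \<and> b \<in> p"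
  by (meson Ult_mono Ult_proper_filter inf.cobounded1 inf.cobounded2 proper_filter_def)

lemma Ult_compl:
  assumes "p \<in> Ult"
  shows "- a \<in> p \<longleftrightarrow> a \<notin> p"
proof
  show "- a \<in> p \<Longrightarrow> a \<notin> p"
    using Ult_inf[OF assms, of a "- a"] Ult_bot[OF assms] by auto
  assume "a \<notin> p"
  \<comment> \<open>The filter generated by \<open>p\<close> and \<open>a\<close>. It properly
    extends \<open>p\<close>, so it is improper, and some \<open>y\<close> in \<open>p\<close> is
    disjoint from \<open>a\<close>.\<close>
  define q where "q = {x. \<exists>y\<in>p. inf y a \<le> x}"
  have q: "p \<subseteq> q" "a \<in> q"
    using Ult_top[OF assms] by (auto simp: q_def intro: le_infI1 inf.cobounded2)
  then have "\<not> proper_filter q" using \<open>a \<notin> p\<close> assms unfolding Ult_def by blast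
  moreover have "inf x y \<in> q" if "x \<in> q" "y \<in> q" for x y
  proof -
    obtain s t where "s \<in> p" "inf s a \<le> x" "t \<in> p" "inf t a \<le> y"
      using \<open>x \<in> q\<close> \<open>y \<in> q\<close> by (auto simp: q_def)
    moreover have "inf (inf s t) a \<le> inf (inf s a) (inf t a)"
      by (simp add: inf.coboundedI1 inf.coboundedI2)
    ultimately show ?thesis
      unfolding q_def using Ult_inf[OF assms] inf_mono order_trans by blast
  qed
  moreover have "top \<in> q" using q Ult_top[OF assms] by blast
  moreover have "\<forall>x\<in>q. \<forall>y. x \<le> y \<longrightarrow> y \<in> q" unfolding q_def using order_trans by blast
  ultimately have "bot \<in> q" unfolding proper_filter_def by blast
  then obtain y where "y \<in> p" "y \<le> - a" by (auto simp: q_def inf_shunt bot_unique)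
  then show "- a \<in> p" using Ult_mono assms by blast
qed

lemma Ult_sup: "p \<in> Ult \<Longrightarrow> sup a b \<in> p \<longleftrightarrow> a \<in> p \<or> b \<in> p"
  using Ult_compl[of p "sup a b"] Ult_compl[of p a] Ult_compl[of p b] Ult_inf[of p "- a" "- b"]
  by auto

text \<open>If \<open>x \<le> y\<close> fails, the principal filter of \<open>inf x (- y)\<close> is
  proper and extends to an ultrafilter containing \<open>x\<close> but not \<open>y\<close>.\<close>

lemma Ult_separates:
  assumes "a \<noteq> b"
  obtains p where "p \<in> Ult" "a \<in> p \<longleftrightarrow> b \<notin> p"
proof -
  have sep: "\<exists>p\<in>Ult. x \<in> p \<and> y \<notin> p" if "\<not> x \<le> y" for x y :: 'a
  proof -
    have "inf x (- y) \<noteq> bot" using that by (simp add: inf_shunt)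
    then have "proper_filter {z. inf x (- y) \<le> z}"
      by (auto simp: proper_filter_def bot_unique intro: order_trans)
    then obtain p where "p \<in> Ult" "{z. inf x (- y) \<le> z} \<subseteq> p"
      using proper_filter_extends by blast
    then have "inf x (- y) \<in> p" by blast
    then show ?thesis using \<open>p \<in> Ult\<close> by (auto simp: Ult_inf Ult_compl)
  qed
  have "\<not> a \<le> b \<or> \<not> b \<le> a" using assms by auto
  then show thesis using sep that by metis
qed

lemma Ult_eqI:
  assumes "\<And>p. p \<in> Ult \<Longrightarrow> a \<in> p \<longleftrightarrow> b \<in> p"
  shows "a = b"
  using Ult_separates[of a b] assms by blast

definition stone :: "'a::boolean_algebra \<Rightarrow> 'a set set" where
  "stone a = {p \<in> Ult. a \<in> p}"

lemma inj_stone: "inj stone"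
proof (rule injI, rule ccontr)
  fix a b :: 'a assume "stone a = stone b" "a \<noteq> b"
  then show False using Ult_separates[OF \<open>a \<noteq> b\<close>] unfolding stone_def by blast
qed

lemma stone_topology_eq: "stone_topology = topology_generated_by (range stone)"
  by (simp add: stone_topology_def stone_def full_SetCompr_eq)

lemma topspace_stone_topology: "topspace stone_topology = Ult"
  unfolding stone_topology_eq topology_generated_by_topspace using Ult_top by (auto simp: stone_def)

lemma openin_stone: "openin stone_topology (stone a)"
  unfolding stone_topology_eq by (rule topology_generated_by_Basis) simp

lemma closedin_stone: "closedin stone_topology (stone a)"
proof -
  have "Ult - stone a = stone (- a)" by (auto simp: stone_def Ult_compl)
  then show ?thesis
    using openin_stone[of "- a"] by (auto simp: closedin_def topspace_stone_topology stone_def)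
qed

text \<open>The subbase is closed under binary intersections, via \<open>inf\<close>, so it is
  already a base.\<close>

lemma openin_stone_topology_base:
  assumes "openin stone_topology U" "p \<in> U"
  shows "\<exists>a. p \<in> stone a \<and> stone a \<subseteq> U"
proof -
  have "generate_topology_on (range stone) U"
    using assms(1) unfolding stone_topology_eq by (rule openin_topology_generated_by)
  then show ?thesis using \<open>p \<in> U\<close>
  proof (induction arbitrary: p)
    case (Int U V)
    then obtain a b where "p \<in> stone a" "stone a \<subseteq> U" "p \<in> stone b" "stone b \<subseteq> V" by blast
    moreover have "stone (inf a b) = stone a \<inter> stone b" by (auto simp: stone_def Ult_inf)
    ultimately show ?case by (intro exI[of _ "inf a b"]) auto
  next
    case (UN K)
    then show ?case by (meson Sup_upper UnionE order_trans)
  qed auto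
qed

text \<open>A compact open set is a finite union of basic ones, and finite unions are realized by
  joins. Compactness is assumed here because the semilattice structure supplies it.\<close>

lemma clopen_stone_topology:
  fixes U :: "'a::boolean_algebra set set"
  assumes "compact_space (stone_topology :: 'a set topology)"
    and U: "openin stone_topology U" "closedin stone_topology U"
  obtains a where "U = stone a"
proof -
  have "compactin stone_topology U"
    using assms(1) U(2) closedin_compact_space by blast
  moreover have "U \<subseteq> \<Union>(stone ` {a. stone a \<subseteq> U})"
    using openin_stone_topology_base[OF U(1)] by blast
  moreover have "\<forall>V\<in>stone ` {a. stone a \<subseteq> U}. openin stone_topology V"
    using openin_stone by blast
  ultimately obtain \<F> where "finite \<F>" "\<F> \<subseteq> stone ` {a. stone a \<subseteq> U}" "U \<subseteq> \<Union>\<F>"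
    unfolding compactin_def by meson
  moreover then obtain A where A: "A \<subseteq> {a. stone a \<subseteq> U}" "finite A" "\<F> = stone ` A"
    using finite_subset_image by metis
  ultimately have "U = (\<Union>a\<in>A. stone a)" by auto
  also have "\<exists>b. (\<Union>a\<in>A. stone a) = stone b"
    using \<open>finite A\<close>
  proof (induction A)
    case empty
    have "stone bot = {}" by (auto simp: stone_def Ult_bot)
    then show ?case by auto
  next
    case (insert a A)
    then obtain b where "(\<Union>a\<in>A. stone a) = stone b" by blast
    then have "(\<Union>a\<in>insert a A. stone a) = stone (sup a b)" by (auto simp: stone_def Ult_sup)
    then show ?case by blast
  qed
  finally show thesis using that by blast
qed

section \<open>Closed discrete sets in the pointwise topology\<close>

text \<open>Every point \<open>u\<close> of the algebra, in \<open>C\<close> or not, has a basic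
  pointwise neighbourhood, given by \<open>P\<close>, with at most one element of \<open>C\<close>.
  The finite set \<open>P\<close> is kept explicit because the argument on generating sets works
  with its members.\<close>

definition locally_isolated :: "'a::boolean_algebra set \<Rightarrow> bool" where
  "locally_isolated C \<longleftrightarrow> (\<forall>u. \<exists>P\<subseteq>Ult. finite P \<and> (\<forall>c\<in>C. \<forall>c'\<in>C.
     (\<forall>p\<in>P. u \<in> p \<longleftrightarrow> c \<in> p) \<longrightarrow> (\<forall>p\<in>P. u \<in> p \<longleftrightarrow> c' \<in> p) \<longrightarrow> c = c'))"

lemma topspace_pointwise_topology: "topspace pointwise_topology = UNIV"
  unfolding pointwise_topology_def topology_generated_by_topspace by blast

lemma openin_pointwise_topology:
  assumes "finite P" "P \<subseteq> Ult"
  shows "openin pointwise_topology {a. \<forall>p\<in>P. u \<in> p \<longleftrightarrow> a \<in> p}"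
proof -
  have "openin pointwise_topology {a. u \<in> p \<longleftrightarrow> a \<in> p}" if "p \<in> Ult" for p
    unfolding pointwise_topology_def using that
    by (intro topology_generated_by_Basis) (cases "u \<in> p"; force)
  then have "openin pointwise_topology (\<Inter>(insert UNIV ((\<lambda>p. {a. u \<in> p \<longleftrightarrow> a \<in> p}) ` P)))"
    using assms openin_topspace[of pointwise_topology]
    by (intro openin_Inter) (auto simp: topspace_pointwise_topology)
  moreover have "\<Inter>(insert UNIV ((\<lambda>p. {a. u \<in> p \<longleftrightarrow> a \<in> p}) ` P)) = {a. \<forall>p\<in>P. u \<in> p \<longleftrightarrow> a \<in> p}"
    by auto
  ultimately show ?thesis by simp
qed

text \<open>Stated for all subsets of \<open>C\<close>, so that discreteness follows as
  well.\<close>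

lemma locally_isolated_closedin:
  assumes "locally_isolated C" "S \<subseteq> C"
  shows "closedin pointwise_topology S"
proof -
  have "\<exists>V. openin pointwise_topology V \<and> u \<in> V \<and> V \<subseteq> - S" if "u \<notin> S" for u
  proof -
    obtain P where P: "P \<subseteq> Ult" "finite P" and "\<forall>c\<in>C. \<forall>c'\<in>C.
      (\<forall>p\<in>P. u \<in> p \<longleftrightarrow> c \<in> p) \<longrightarrow> (\<forall>p\<in>P. u \<in> p \<longleftrightarrow> c' \<in> p) \<longrightarrow> c = c'"
      using assms(1)[unfolded locally_isolated_def, THEN spec, of u] by (elim exE conjE)
    then have uniq: "c = c'" if "c \<in> C" "c' \<in> C" "\<forall>p\<in>P. u \<in> p \<longleftrightarrow> c \<in> p" "\<forall>p\<in>P. u \<in> p \<longleftrightarrow> c' \<in> p" for c c'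
      using that by simp
    show ?thesis
    proof (cases "\<exists>c\<in>S. \<forall>p\<in>P. u \<in> p \<longleftrightarrow> c \<in> p")
      case False
      then show ?thesis using openin_pointwise_topology[OF P(2,1), of u] by blast
    next
      case True
      \<comment> \<open>The only element of \<open>S\<close> in the neighbourhood is
        \<open>c\<close>; adding an ultrafilter that separates \<open>c\<close> from
        \<open>u\<close> removes it.\<close>
      then obtain c where c: "c \<in> S" "\<forall>p\<in>P. u \<in> p \<longleftrightarrow> c \<in> p" by blast
      then obtain q where q: "q \<in> Ult" "u \<in> q \<longleftrightarrow> c \<notin> q"
        using Ult_separates[of u c] \<open>u \<notin> S\<close> by blast
      have "finite (insert q P)" "insert q P \<subseteq> Ult" using P q by auto
      note openin_pointwise_topology[OF this, of u]
      moreover have "a \<notin> S" if "\<forall>p\<in>insert q P. u \<in> p \<longleftrightarrow> a \<in> p" for a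
        using that uniq[of a c] c q assms(2) by auto
      ultimately show ?thesis by blast
    qed
  qed
  then have "openin pointwise_topology (- S)"
    by (subst openin_subopen) (auto simp: subset_eq)
  then show ?thesis
    by (simp add: closedin_def topspace_pointwise_topology Compl_eq_Diff_UNIV)
qed

lemma locally_isolated_closed_discrete:
  assumes "locally_isolated C"
  shows "closed_discrete_in pointwise_topology C"
proof -
  have "openin (subtopology pointwise_topology C) {x}" if "x \<in> C" for x
  proof -
    have "openin pointwise_topology (UNIV - (C - {x}))"
      using locally_isolated_closedin[OF assms, of "C - {x}"]
      by (auto simp: closedin_def topspace_pointwise_topology)
    moreover have "{x} = (UNIV - (C - {x})) \<inter> C" using that by blast
    ultimately show ?thesis by (metis openin_subtopology)
  qed
  then have "discrete_topology C = subtopology pointwise_topology C"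
    by (simp add: discrete_topology_unique topspace_pointwise_topology)
  then show ?thesis
    using locally_isolated_closedin[OF assms] by (simp add: closed_discrete_in_def)
qed

section \<open>Generating sets\<close>

lemma boolean_subalgebra_hull: "boolean_subalgebra (boolean_subalgebra hull S)"
  by (rule hull_in) (auto simp: boolean_subalgebra_def)

text \<open>Adjoining one generator \<open>g\<close> to a finite subalgebra gives only elements that
  are determined by a pair from it: one value on \<open>g\<close>, one on
  \<open>- g\<close>.\<close>

lemma boolean_subalgebra_hull_finite:
  assumes "finite R"
  shows "finite (boolean_subalgebra hull R)"
  using assms
proof (induction R)
  case empty
  have "boolean_subalgebra {bot, top}" by (auto simp: boolean_subalgebra_def)
  then have "boolean_subalgebra hull {} \<subseteq> {bot, top}" by (intro hull_minimal) auto
  then show ?case using finite_subset by blast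
next
  case (insert g R)
  let ?H = "boolean_subalgebra hull R"
  \<comment> \<open>Read \<open>f x y\<close> as: \<open>x\<close> where \<open>g\<close> holds,
    \<open>y\<close> elsewhere. The Boolean operations then act coordinatewise, which is checked at
    each ultrafilter.\<close>
  define f where "f x y = sup (inf g x) (inf (- g) y)" for x y
  have mem_f: "f x y \<in> p \<longleftrightarrow> (if g \<in> p then x \<in> p else y \<in> p)" if "p \<in> Ult" for x y p
    using that by (simp add: f_def Ult_inf Ult_sup Ult_compl)
  have f_same: "f x x = x" for x
    by (rule Ult_eqI) (simp add: mem_f)
  have f_compl: "- f x y = f (- x) (- y)" for x y
    by (rule Ult_eqI) (simp add: mem_f Ult_compl)
  have f_inf: "inf (f x y) (f x' y') = f (inf x x') (inf y y')" for x y x' y'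
    by (rule Ult_eqI) (simp add: mem_f Ult_inf)
  have f_sup: "sup (f x y) (f x' y') = f (sup x x') (sup y y')" for x y x' y'
    by (rule Ult_eqI) (simp add: mem_f Ult_sup)
  have f_g: "f top bot = g" by (simp add: f_def)
  let ?H = "boolean_subalgebra hull R"
  define S where "S = (\<lambda>(x, y). f x y) ` (?H \<times> ?H)"
  have H: "bot \<in> ?H" "top \<in> ?H" "\<And>a. a \<in> ?H \<Longrightarrow> - a \<in> ?H"
    "\<And>a b. a \<in> ?H \<Longrightarrow> b \<in> ?H \<Longrightarrow> inf a b \<in> ?H" "\<And>a b. a \<in> ?H \<Longrightarrow> b \<in> ?H \<Longrightarrow> sup a b \<in> ?H"
    using boolean_subalgebra_hull[of R] unfolding boolean_subalgebra_def by auto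
  have S: "f x y \<in> S" if "x \<in> ?H" "y \<in> ?H" for x y
    using that by (auto simp: S_def)
  have HS: "?H \<subseteq> S" using S f_same by (metis subsetI)
  have "boolean_subalgebra S"
    unfolding boolean_subalgebra_def
  proof (intro conjI ballI)
    fix a assume "a \<in> S"
    then obtain x y where a: "x \<in> ?H" "y \<in> ?H" "a = f x y" by (auto simp: S_def)
    then show "- a \<in> S" using S H f_compl by simp
    fix b assume "b \<in> S"
    then obtain x' y' where b: "x' \<in> ?H" "y' \<in> ?H" "b = f x' y'" by (auto simp: S_def)
    show "inf a b \<in> S" "sup a b \<in> S" using S H a b f_inf f_sup by simp_all
  qed (use HS H in auto)
  moreover have "insert g R \<subseteq> S"
    using HS S[OF H(2,1)] f_g hull_subset[of R boolean_subalgebra] by auto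
  ultimately have "boolean_subalgebra hull (insert g R) \<subseteq> S"
    by (intro hull_minimal)
  moreover have "finite S" using insert.IH by (simp add: S_def)
  ultimately show ?case using finite_subset by blast
qed

text \<open>The elements with a finite support in \<open>G\<close> form a subalgebra: the union of
  two supports serves both operands.\<close>

lemma boolean_subalgebra_hull_finite_support:
  assumes "a \<in> boolean_subalgebra hull G"
  obtains F where "finite F" "F \<subseteq> G" "a \<in> boolean_subalgebra hull F"
proof -
  let ?S = "{a. \<exists>F. finite F \<and> F \<subseteq> G \<and> a \<in> boolean_subalgebra hull F}"
  have hull: "bot \<in> boolean_subalgebra hull F" "top \<in> boolean_subalgebra hull F"
    "\<And>a. a \<in> boolean_subalgebra hull F \<Longrightarrow> - a \<in> boolean_subalgebra hull F"
    "\<And>a b. a \<in> boolean_subalgebra hull F \<Longrightarrow> b \<in> boolean_subalgebra hull F \<Longrightarrow>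
      inf a b \<in> boolean_subalgebra hull F \<and> sup a b \<in> boolean_subalgebra hull F" for F :: "'a set"
    using boolean_subalgebra_hull[of F] unfolding boolean_subalgebra_def by auto
  have "inf a b \<in> ?S \<and> sup a b \<in> ?S" if ab: "a \<in> ?S" "b \<in> ?S" for a b
  proof -
    obtain E F where E: "finite E" "E \<subseteq> G" "a \<in> boolean_subalgebra hull E"
      and F: "finite F" "F \<subseteq> G" "b \<in> boolean_subalgebra hull F" using ab by blast
    then have "a \<in> boolean_subalgebra hull (E \<union> F)" "b \<in> boolean_subalgebra hull (E \<union> F)"
      using hull_mono[of E "E \<union> F"] hull_mono[of F "E \<union> F"] by blast+
    then have "inf a b \<in> boolean_subalgebra hull (E \<union> F)" "sup a b \<in> boolean_subalgebra hull (E \<union> F)"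
      using hull by auto
    moreover have "finite (E \<union> F)" "E \<union> F \<subseteq> G" using E F by auto
    ultimately show ?thesis by blast
  qed
  moreover have "bot \<in> ?S" "top \<in> ?S" using hull(1,2)[of "{}"] by blast+
  moreover have "\<forall>a\<in>?S. - a \<in> ?S" using hull(3) by blast
  ultimately have "boolean_subalgebra ?S" unfolding boolean_subalgebra_def by blast
  moreover have "g \<in> ?S" if "g \<in> G" for g
    using that hull_inc[of g "{g}" boolean_subalgebra] by (intro CollectI exI[of _ "{g}"]) auto
  ultimately have "boolean_subalgebra hull G \<subseteq> ?S" by (intro hull_minimal) auto
  then show thesis using assms that by blast
qed

text \<open>The element of the conclusion arises from \<open>a\<close> by substituting \<open>bot\<close> for the generators outside \<open>R\<close>.\<close>

lemma boolean_subalgebra_hull_restrict: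
  assumes "a \<in> boolean_subalgebra hull F"
  shows "\<exists>r\<in>boolean_subalgebra hull R. \<forall>p\<in>Ult. p \<inter> F \<subseteq> R \<longrightarrow> (a \<in> p \<longleftrightarrow> r \<in> p)"
proof -
  let ?H = "boolean_subalgebra hull R"
  define S where "S = {a. \<exists>r\<in>?H. \<forall>p\<in>Ult. p \<inter> F \<subseteq> R \<longrightarrow> (a \<in> p \<longleftrightarrow> r \<in> p)}"
  have H: "bot \<in> ?H" "top \<in> ?H" "\<And>a. a \<in> ?H \<Longrightarrow> - a \<in> ?H"
    "\<And>a b. a \<in> ?H \<Longrightarrow> b \<in> ?H \<Longrightarrow> inf a b \<in> ?H" "\<And>a b. a \<in> ?H \<Longrightarrow> b \<in> ?H \<Longrightarrow> sup a b \<in> ?H"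
    using boolean_subalgebra_hull[of R] unfolding boolean_subalgebra_def by auto
  have "inf a b \<in> S" "sup a b \<in> S" if ab: "a \<in> S" "b \<in> S" for a b
  proof -
    obtain r s where "r \<in> ?H" "\<forall>p\<in>Ult. p \<inter> F \<subseteq> R \<longrightarrow> (a \<in> p \<longleftrightarrow> r \<in> p)"
      "s \<in> ?H" "\<forall>p\<in>Ult. p \<inter> F \<subseteq> R \<longrightarrow> (b \<in> p \<longleftrightarrow> s \<in> p)"
      using ab by (auto simp: S_def)
    then have "inf r s \<in> ?H" "\<forall>p\<in>Ult. p \<inter> F \<subseteq> R \<longrightarrow> (inf a b \<in> p \<longleftrightarrow> inf r s \<in> p)"
      "sup r s \<in> ?H" "\<forall>p\<in>Ult. p \<inter> F \<subseteq> R \<longrightarrow> (sup a b \<in> p \<longleftrightarrow> sup r s \<in> p)"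
      using H by (auto simp: Ult_inf Ult_sup)
    then show "inf a b \<in> S" "sup a b \<in> S" unfolding S_def by blast+
  qed
  moreover have "- a \<in> S" if a: "a \<in> S" for a
  proof -
    obtain r where "r \<in> ?H" "\<forall>p\<in>Ult. p \<inter> F \<subseteq> R \<longrightarrow> (a \<in> p \<longleftrightarrow> r \<in> p)"
      using a by (auto simp: S_def)
    then show ?thesis
      using H(3) unfolding S_def by (intro CollectI bexI[of _ "- r"]) (auto simp: Ult_compl)
  qed
  moreover have "bot \<in> S" "top \<in> S" using H by (auto simp: S_def)
  ultimately have "boolean_subalgebra S" by (simp add: boolean_subalgebra_def)
  moreover have "g \<in> S" if "g \<in> F" for g
  proof (cases "g \<in> R")
    case True
    then show ?thesis using hull_inc[of g R boolean_subalgebra] by (auto simp: S_def)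
  next
    \<comment> \<open>A generator outside \<open>R\<close> lies in no ultrafilter whose trace on
      \<open>F\<close> is inside \<open>R\<close>, so there it acts as \<open>bot\<close>.\<close>
    case False
    then show ?thesis
      using that H(1) unfolding S_def by (intro CollectI bexI[of _ bot]) (auto simp: Ult_bot)
  qed
  ultimately have "boolean_subalgebra hull F \<subseteq> S" by (intro hull_minimal) auto
  then show ?thesis using assms by (auto simp: S_def)
qed

text \<open>A variant of the Delta-system argument: with \<open>R\<close> a maximal finite set contained in \<open>r\<close> many
  supports, the elements with supports containing \<open>R\<close> converge to one with support in \<open>R\<close>.\<close>

lemma locally_isolated_not_small_traces:
  fixes G C :: "'a::boolean_algebra set"
  assumes r: "regular_cardinal r" and unc: "|UNIV :: nat set| <o r"
    and G: "generates_algebra G" and small: "\<And>p. p \<in> Ult \<Longrightarrow> |p \<inter> G| <o r"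
    and C: "locally_isolated C" "r \<le>o |C|"
  shows False
proof -
  note stable = regular_cardinal_stable[OF r]
  have co: "Card_order r" using r by (simp add: regular_cardinal_def)
  have big: "\<not> |C| <o r" using C(2) co card_of_not_less_iff by blast
  have "\<exists>F. finite F \<and> F \<subseteq> G \<and> c \<in> boolean_subalgebra hull F" for c :: 'a
    using boolean_subalgebra_hull_finite_support[of c G] G unfolding generates_algebra_def
    by (metis UNIV_I)
  then obtain F where F: "\<And>c. finite (F c)" "\<And>c. F c \<subseteq> G" "\<And>c. c \<in> boolean_subalgebra hull (F c)"
    by metis
  \<comment> \<open>Uncountability of \<open>r\<close> allows supports of one common size, which
    bounds the cardinality of every member of \<open>\<R>\<close> below.\<close>
  obtain n where n: "\<not> |{c \<in> C. card (F c) = n}| <o r"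
    using stable_pigeonhole[OF stable unc, of "\<lambda>c. card (F c)" C] big by auto
  define C1 where "C1 = {c \<in> C. card (F c) = n}"
  define \<R> where "\<R> = {R. finite R \<and> \<not> |{c \<in> C1. R \<subseteq> F c}| <o r}"
  have "{} \<in> \<R>" using n by (simp add: \<R>_def C1_def)
  moreover have "\<forall>R. R \<in> \<R> \<longrightarrow> card R < Suc n"
  proof (intro allI impI)
    fix R assume "R \<in> \<R>"
    then have "\<not> |{c \<in> C1. R \<subseteq> F c}| <o r" by (simp add: \<R>_def)
    then have "{c \<in> C1. R \<subseteq> F c} \<noteq> {}"
      using regular_cardinal_finite_less[OF r finite.emptyI] by metis
    then show "card R < Suc n" using F(1) by (auto simp: C1_def less_Suc_eq_le intro: card_mono)
  qed
  ultimately have "\<exists>R. R \<in> \<R> \<and> (\<forall>R'. R' \<in> \<R> \<longrightarrow> card R' \<le> card R)"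
    by (rule ex_has_greatest_nat[of "\<lambda>R. R \<in> \<R>" "{}" card "Suc n"])
  then obtain R where R: "R \<in> \<R>" "\<forall>R'. R' \<in> \<R> \<longrightarrow> card R' \<le> card R"
    by (elim exE conjE)
  have "finite R" using R by (simp add: \<R>_def)
  define C2 where "C2 = {c \<in> C1. R \<subseteq> F c}"
  have C2: "\<not> |C2| <o r" using R by (simp add: \<R>_def C2_def)
  \<comment> \<open>By maximality of \<open>R\<close>, no further generator lies in \<open>r\<close>
    many of the remaining supports.\<close>
  have thin: "|{c \<in> C2. g \<in> F c}| <o r" if "g \<notin> R" for g
  proof -
    have "card (insert g R) > card R" using that \<open>finite R\<close> by simp
    then have "insert g R \<notin> \<R>" using R(2) by fastforce
    moreover have "{c \<in> C2. g \<in> F c} = {c \<in> C1. insert g R \<subseteq> F c}" by (auto simp: C2_def)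
    ultimately show ?thesis using \<open>finite R\<close> by (simp add: \<R>_def)
  qed
  obtain f where f: "\<And>c. f c \<in> boolean_subalgebra hull R"
    "\<And>c p. p \<in> Ult \<Longrightarrow> p \<inter> F c \<subseteq> R \<Longrightarrow> c \<in> p \<longleftrightarrow> f c \<in> p"
    using boolean_subalgebra_hull_restrict[OF F(3)] by metis
  \<comment> \<open>The restrictions to \<open>R\<close> lie in a finite algebra, so many elements
    share the restriction \<open>x\<close>; it is the limit at which local isolation is
    tested.\<close>
  obtain x where x: "\<not> |{c \<in> C2. f c = x}| <o r"
    using stable_pigeonhole[OF stable _ _ C2, of "boolean_subalgebra hull R" f] f(1)
      regular_cardinal_finite_less[OF r boolean_subalgebra_hull_finite[OF \<open>finite R\<close>]] by blast
  define C3 where "C3 = {c \<in> C2. f c = x}"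
  obtain P where P: "P \<subseteq> Ult" "finite P" and "\<forall>c\<in>C. \<forall>c'\<in>C.
    (\<forall>p\<in>P. x \<in> p \<longleftrightarrow> c \<in> p) \<longrightarrow> (\<forall>p\<in>P. x \<in> p \<longleftrightarrow> c' \<in> p) \<longrightarrow> c = c'"
    using C(1)[unfolded locally_isolated_def, THEN spec, of x] by (elim exE conjE)
  then have uniq: "c = c'" if "c \<in> C" "c' \<in> C" "\<forall>p\<in>P. x \<in> p \<longleftrightarrow> c \<in> p" "\<forall>p\<in>P. x \<in> p \<longleftrightarrow> c' \<in> p" for c c'
    using that by simp
  \<comment> \<open>The exceptions: elements whose support has a generator outside \<open>R\<close>
    in some \<open>p\<close> from \<open>P\<close>. Small traces, \<open>thin\<close> and stability
    keep this set small; off it, elements of \<open>C3\<close> agree with \<open>x\<close> on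
    \<open>P\<close>.\<close>
  define E where "E = (\<Union>p\<in>P. \<Union>g\<in>p \<inter> G - R. {c \<in> C2. g \<in> F c})"
  have "|E| <o r"
    unfolding E_def
  proof (rule stable_UNION[OF stable])
    show "|P| <o r" using regular_cardinal_finite_less[OF r P(2)] .
    show "|\<Union>g\<in>p \<inter> G - R. {c \<in> C2. g \<in> F c}| <o r" if "p \<in> P" for p
    proof (rule stable_UNION[OF stable])
      have "|p \<inter> G - R| \<le>o |p \<inter> G|" by (rule card_of_mono1) blast
      then show "|p \<inter> G - R| <o r" using small P(1) that ordLeq_ordLess_trans by blast
    qed (use thin in blast)
  qed
  have agree: "\<forall>p\<in>P. x \<in> p \<longleftrightarrow> c \<in> p" if "c \<in> C3 - E" for c
  proof
    fix p assume "p \<in> P"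
    then have "p \<inter> F c \<subseteq> R" using that F(2)[of c] by (auto simp: E_def C3_def)
    then show "x \<in> p \<longleftrightarrow> c \<in> p" using f(2)[of p c] that \<open>p \<in> P\<close> P(1) by (auto simp: C3_def)
  qed
  have "C3 \<subseteq> C" by (auto simp: C3_def C2_def C1_def)
  \<comment> \<open>Local isolation leaves at most one element outside \<open>E\<close>, so
    \<open>C3\<close> would be small after all.\<close>
  have "c = c'" if c: "c \<in> C3 - E" "c' \<in> C3 - E" for c c'
  proof (rule uniq)
    show "c \<in> C" "c' \<in> C" using c \<open>C3 \<subseteq> C\<close> by auto
  qed (rule agree[OF c(1)], rule agree[OF c(2)])
  then obtain c where "C3 - E \<subseteq> {c}"
    by (metis insertI1 subsetI)
  then have "|C3 - E| <o r"
    by (intro regular_cardinal_finite_less[OF r]) (rule finite_subset, auto)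
  then have "|(C3 - E) \<union> E| <o r" using \<open>|E| <o r\<close> regular_cardinal_Un_less[OF r] by blast
  moreover have "|C3| \<le>o |(C3 - E) \<union> E|" by (rule card_of_mono1) blast
  ultimately show False using x ordLeq_ordLess_trans unfolding C3_def by blast
qed

section \<open>Many open elements below one maximal element\<close>

text \<open>Up-sets of open elements and their complements separate points, so each clopen set is
  coded by a finite set of finite sets of them, and such codes do not raise an infinite
  cardinality.\<close>

lemma (in compact_zero_dim_semilattice) card_of_clopen_le_open_elements:
  assumes "infinite {U. openin X U \<and> closedin X U}"
  shows "|{U. openin X U \<and> closedin X U}| \<le>o |open_elements|"
proof -
  define up where "up t = {u \<in> L. t \<sqsubseteq> u}" for t
  \<comment> \<open>Complements are included because distinct points may be comparable, while
    separation is required for both orders of the pair.\<close>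
  define \<F> where "\<F> = up ` open_elements \<union> (\<lambda>t. L - up t) ` open_elements"
  let ?clopen = "{U. openin X U \<and> closedin X U}"
  let ?f = "\<lambda>\<E>. \<Union>E\<in>\<E>. L \<inter> \<Inter>E"
  have up: "openin X (up t)" "closedin X (up t)" if "t \<in> open_elements" for t
    using that closedin_ge by (auto simp: open_elements_def up_def)
  have \<F>: "openin X F \<and> closedin X F" if F: "F \<in> \<F>" for F
    using F
    unfolding \<F>_def
  proof
    assume "F \<in> up ` open_elements"
    then show ?thesis using up by blast
  next
    assume "F \<in> (\<lambda>t. L - up t) ` open_elements"
    then show ?thesis using up by (blast intro: openin_diff closedin_diff)
  qed
  have sep: "\<exists>F\<in>\<F>. p \<in> F \<and> q \<notin> F" if pq: "p \<in> L" "q \<in> L" "p \<noteq> q" for p q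
  proof -
    have "\<not> p \<sqsubseteq> q \<or> \<not> q \<sqsubseteq> p" using pq le_antisym by blast
    then show ?thesis
    proof
      assume "\<not> p \<sqsubseteq> q"
      then obtain t where "t \<in> open_elements" "t \<sqsubseteq> p" "\<not> t \<sqsubseteq> q"
        using open_elements_separate pq by blast
      then show ?thesis using pq by (intro bexI[of _ "up t"]) (auto simp: \<F>_def up_def)
    next
      assume "\<not> q \<sqsubseteq> p"
      then obtain t where "t \<in> open_elements" "t \<sqsubseteq> q" "\<not> t \<sqsubseteq> p"
        using open_elements_separate pq by blast
      then show ?thesis using pq by (intro bexI[of _ "L - up t"]) (auto simp: \<F>_def up_def)
    qed
  qed
  have "?clopen \<subseteq> ?f ` Fpow (Fpow \<F>)"
    using clopen_in_boolean_closure[OF compact \<F> sep] by (auto simp: image_iff)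
  then have le: "|?clopen| \<le>o |Fpow (Fpow \<F>)|" by (rule surj_imp_ordLeq)
  have "infinite \<F>"
  proof
    assume "finite \<F>"
    then have "finite (Fpow (Fpow \<F>))" by (simp add: Fpow_Pow_finite)
    then show False using le assms card_of_ordLeq_finite by blast
  qed
  then have "infinite (Fpow \<F>)"
    using card_of_ordLeq_finite[of \<F> "Fpow \<F>"] card_of_ordLeqI[of "\<lambda>a. {a}" \<F> "Fpow \<F>"]
    by (auto simp: Fpow_def)
  then have "|Fpow (Fpow \<F>)| \<le>o |\<F>|"
    using card_of_Fpow_le[of "Fpow \<F>"] card_of_Fpow_le[OF \<open>infinite \<F>\<close>] ordLeq_transitive by blast
  moreover have "|\<F>| \<le>o |open_elements|"
  proof -
    have "infinite open_elements"
      using \<open>infinite \<F>\<close> by (auto simp: \<F>_def)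
    then show ?thesis
      unfolding \<F>_def by (intro card_of_Un_ordLeq_infinite_Field card_of_image card_of_Card_order)
        (simp add: Field_card_of)
  qed
  ultimately show ?thesis using ordLeq_transitive[OF le] ordLeq_transitive by blast
qed

text \<open>Some maximal element lies above \<open>t\<close>, so the open up-set of \<open>t\<close>
  meets the maximal elements and hence contains a point of \<open>D\<close>.\<close>

lemma (in compact_zero_dim_semilattice) open_element_below_dense:
  assumes D: "dense_subset_of (subtopology X (maximal_elements L meet)) D"
    and t: "t \<in> open_elements"
  shows "\<exists>d\<in>D. d \<in> L \<and> t \<sqsubseteq> d"
proof -
  let ?M = "maximal_elements L meet"
  have tL: "t \<in> L" "openin X {u \<in> L. t \<sqsubseteq> u}" using t by (auto simp: open_elements_def)
  obtain m where m: "m \<in> L" "t \<sqsubseteq> m" "\<And>y. y \<in> L \<Longrightarrow> m \<sqsubseteq> y \<Longrightarrow> y = m"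
    using maximal_above[of L t] tL by blast
  then have "m \<in> ?M" by (auto simp: maximal_elements_def meet_less_def)
  then have "m \<in> subtopology X ?M closure_of D"
    using D m by (simp add: dense_subset_of_def)
  then have dense: "\<exists>d\<in>D. d \<in> V" if "openin (subtopology X ?M) V" "m \<in> V" for V
    using that by (auto simp: in_closure_of)
  have "openin (subtopology X ?M) ({u \<in> L. t \<sqsubseteq> u} \<inter> ?M)"
    using tL openin_subtopology by blast
  then have "\<exists>d\<in>D. d \<in> {u \<in> L. t \<sqsubseteq> u} \<inter> ?M"
    by (rule dense) (use \<open>m \<in> ?M\<close> m in simp)
  then show ?thesis by blast
qed

text \<open>The cardinality of \<open>K\<close> may be singular. If \<open>D\<close> is smaller than
  \<open>r\<close>, regularity of \<open>r\<close> applies; otherwise a union of \<open>|D|\<close>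
  sets, each of size below \<open>r \<le>o |D|\<close>, has size at most \<open>|D|\<close>, which
  is too small for \<open>K\<close>.\<close>

lemma ex_large_fibre:
  assumes r: "regular_cardinal r" and K: "r \<le>o |K|" "|D| <o |K|"
    and cover: "K \<subseteq> (\<Union>d\<in>D. B d)"
  shows "\<exists>d\<in>D. r \<le>o |K \<inter> B d|"
proof (rule ccontr)
  assume "\<not> ?thesis"
  have co: "Card_order r" using r by (simp add: regular_cardinal_def)
  with \<open>\<not> ?thesis\<close> have small: "|K \<inter> B d| <o r" if "d \<in> D" for d
    using that card_of_not_less_iff[OF co] by blast
  have K_eq: "(\<Union>d\<in>D. K \<inter> B d) = K" using cover by blast
  show False
  proof (cases "|D| <o r")
    case True
    have "|\<Union>d\<in>D. K \<inter> B d| <o r"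
      by (rule stable_UNION[OF regular_cardinal_stable[OF r] True]) (rule small)
    then show False using K(1) not_ordLess_ordLeq unfolding K_eq by blast
  next
    case False
    then have rD: "r \<le>o |D|" using card_of_not_less_iff[OF co] by blast
    then have "infinite D" using regular_cardinal_finite_less[OF r] False by blast
    moreover have "|K \<inter> B d| \<le>o |D|" if "d \<in> D" for d
      using small[OF that] rD ordLess_imp_ordLeq ordLeq_transitive by blast
    ultimately have "|\<Union>d\<in>D. K \<inter> B d| \<le>o |D|"
      by (intro card_of_UNION_ordLeq_infinite card_of_mono1) auto
    then show False using K(2) not_ordLess_ordLeq unfolding K_eq by blast
  qed
qed

text \<open>The common source of both claims. The points of the semilattice are ultrafilters, so
  finite sets of points serve directly as finite sets of test ultrafilters.\<close>

lemma ex_locally_isolated: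
  fixes meet :: "'a::boolean_algebra set \<Rightarrow> 'a set \<Rightarrow> 'a set" and r :: "'k rel"
  assumes inf: "infinite (UNIV :: 'a set)"
    and modest: "modest_semilattice (stone_topology :: 'a set topology) meet zero"
    and D: "dense_subset_of (subtopology stone_topology (maximal_elements Ult meet)) D"
      "|D| <o |UNIV :: 'a set|"
    and r: "regular_cardinal r" "r \<le>o |UNIV :: 'a set|"
  shows "\<exists>C :: 'a set. locally_isolated C \<and> |C| =o r"
proof -
  interpret modest_semilattice "stone_topology :: 'a set topology" meet zero by (rule modest)
  have L: "L = Ult" by (rule topspace_stone_topology)
  let ?clopen = "{U :: 'a set set. openin stone_topology U \<and> closedin stone_topology U}"
  have le: "|UNIV :: 'a set| \<le>o |?clopen|"
    by (rule card_of_ordLeqI[OF inj_stone]) (simp add: openin_stone closedin_stone)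
  then have "infinite ?clopen" using inf card_of_ordLeq_finite by blast
  then have K: "|UNIV :: 'a set| \<le>o |open_elements|"
    using ordLeq_transitive[OF le card_of_clopen_le_open_elements] by blast
  have "open_elements \<subseteq> (\<Union>d\<in>D \<inter> L. {t. t \<sqsubseteq> d})"
    using open_element_below_dense D(1) unfolding L by blast
  moreover have "|D \<inter> L| <o |open_elements|"
    using D(2) K card_of_mono1[of "D \<inter> L" D] ordLeq_ordLess_trans ordLess_ordLeq_trans by blast
  ultimately obtain d where d: "d \<in> L" "r \<le>o |open_elements \<inter> {t. t \<sqsubseteq> d}|"
    using ex_large_fibre[OF r(1) ordLeq_transitive[OF r(2) K], of "D \<inter> L" "\<lambda>d. {t. t \<sqsubseteq> d}"] by blast
  \<comment> \<open>\<open>r\<close> is a relation on another type; its field is copied into the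
    open elements below \<open>d\<close> to obtain a set of size exactly \<open>r\<close>.\<close>
  have "|Field r| =o r" using r(1) card_of_Field_ordIso by (auto simp: regular_cardinal_def)
  then have "|Field r| \<le>o |open_elements \<inter> {t. t \<sqsubseteq> d}|" using d(2) ordIso_ordLeq_trans by blast
  from internalize_card_of_ordLeq2[THEN iffD1, OF this]
  obtain A where A0: "A \<subseteq> open_elements \<inter> {t. t \<sqsubseteq> d}" "|Field r| =o |A|"
    by (elim bexE exE conjE)
  then have A: "A \<subseteq> open_elements" "\<And>t. t \<in> A \<Longrightarrow> t \<sqsubseteq> d" by auto
  have A_card: "|A| =o r"
    using ordIso_transitive[OF ordIso_symmetric[OF A0(2)] \<open>|Field r| =o r\<close>] .
  have "\<exists>a. stone a = {u \<in> L. t \<sqsubseteq> u}" if t: "t \<in> open_elements" for t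
  proof -
    have "openin stone_topology {u \<in> L. t \<sqsubseteq> u}" "closedin stone_topology {u \<in> L. t \<sqsubseteq> u}"
      using t closedin_ge by (auto simp: open_elements_def)
    then show ?thesis using clopen_stone_topology[OF compact] by metis
  qed
  \<comment> \<open>\<open>b t\<close> is the element of the algebra whose Stone set is the clopen
    up-set of \<open>t\<close>.\<close>
  then obtain b where b: "\<And>t. t \<in> open_elements \<Longrightarrow> stone (b t) = {u \<in> L. t \<sqsubseteq> u}" by metis
  have mem_b: "b t \<in> p \<longleftrightarrow> t \<sqsubseteq> p" if "t \<in> A" "p \<in> Ult" for t p
    using b[of t] that A(1) L by (auto simp: stone_def)
  \<comment> \<open>Testing \<open>b s = b t\<close> at the points \<open>s\<close> and
    \<open>t\<close> themselves gives both inequalities.\<close>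
  have "inj_on b A"
  proof
    fix s t assume st: "s \<in> A" "t \<in> A" "b s = b t"
    then have "s \<in> L" "t \<in> L" using A(1) by (auto simp: open_elements_def)
    then show "s = t"
      using st mem_b[of s s] mem_b[of t s] mem_b[of s t] mem_b[of t t] le_refl le_antisym L by metis
  qed
  then have "|b ` A| =o r"
    using A_card card_of_ordIsoI[of b A "b ` A"] inj_on_imp_bij_betw ordIso_symmetric ordIso_transitive by blast
  moreover have "locally_isolated (b ` A)"
    unfolding locally_isolated_def
  proof
    fix u :: 'a
    obtain P where P: "P \<subseteq> L" "finite P" and
      uniq: "\<forall>s\<in>open_elements. \<forall>t\<in>open_elements. s \<sqsubseteq> d \<longrightarrow> t \<sqsubseteq> d \<longrightarrow>
        (\<forall>p\<in>P. p \<in> stone u \<longleftrightarrow> s \<sqsubseteq> p) \<longrightarrow> (\<forall>p\<in>P. p \<in> stone u \<longleftrightarrow> t \<sqsubseteq> p) \<longrightarrow> s = t"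
      using finitely_determined_below[OF d(1) openin_stone closedin_stone, of u] by (elim exE conjE)
    have agree: "\<forall>p\<in>P. p \<in> stone u \<longleftrightarrow> t \<sqsubseteq> p" if "t \<in> A" "\<forall>p\<in>P. u \<in> p \<longleftrightarrow> b t \<in> p" for t
      using that mem_b P(1) L by (auto simp: stone_def)
    have "\<forall>c\<in>b ` A. \<forall>c'\<in>b ` A. (\<forall>p\<in>P. u \<in> p \<longleftrightarrow> c \<in> p) \<longrightarrow> (\<forall>p\<in>P. u \<in> p \<longleftrightarrow> c' \<in> p) \<longrightarrow> c = c'"
    proof (intro ballI impI)
      fix c c' assume "c \<in> b ` A" "c' \<in> b ` A"
        and c: "\<forall>p\<in>P. u \<in> p \<longleftrightarrow> c \<in> p" "\<forall>p\<in>P. u \<in> p \<longleftrightarrow> c' \<in> p"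
      then obtain s t where st: "s \<in> A" "c = b s" "t \<in> A" "c' = b t" by blast
      then have "\<forall>p\<in>P. p \<in> stone u \<longleftrightarrow> s \<sqsubseteq> p" "\<forall>p\<in>P. p \<in> stone u \<longleftrightarrow> t \<sqsubseteq> p"
        using agree[of s] agree[of t] c by blast+
      moreover have "s \<in> open_elements" "t \<in> open_elements" "s \<sqsubseteq> d" "t \<sqsubseteq> d"
        using st A by auto
      ultimately have "s = t"
        using uniq[THEN bspec, THEN bspec, THEN mp, THEN mp, THEN mp, THEN mp] by blast
      then show "c = c'" using st by simp
    qed
    then show "\<exists>P\<subseteq>Ult. finite P \<and> (\<forall>c\<in>b ` A. \<forall>c'\<in>b ` A.
        (\<forall>p\<in>P. u \<in> p \<longleftrightarrow> c \<in> p) \<longrightarrow> (\<forall>p\<in>P. u \<in> p \<longleftrightarrow> c' \<in> p) \<longrightarrow> c = c')"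
      using P L by (intro exI[of _ P] conjI) simp_all
  qed
  ultimately show ?thesis by blast
qed

theorem theorem4p10:
  fixes meet :: "'a::boolean_algebra set \<Rightarrow> 'a set \<Rightarrow> 'a set" and zero :: "'a set"
  assumes "infinite (UNIV :: 'a set)"
    and "modest_semilattice (stone_topology :: 'a set topology) meet zero"
    and "\<exists>D. dense_subset_of (subtopology stone_topology (maximal_elements Ult meet)) D
           \<and> |D| <o |UNIV :: 'a set|"
  shows "(\<forall>\<kappa>::'k rel. regular_cardinal \<kappa> \<and> \<kappa> \<le>o |UNIV :: 'a set| \<longrightarrow>
            (\<exists>C::'a set. closed_discrete_in pointwise_topology C \<and> |C| =o \<kappa>))
       \<and> (uncountable (UNIV :: 'a set) \<and> regular_cardinal |UNIV :: 'a set| \<longrightarrow>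
            (\<forall>G::'a set. generates_algebra G \<longrightarrow> (\<exists>p\<in>Ult. |p \<inter> G| =o |UNIV :: 'a set| ))
            \<and> \<not> corson TYPE('a) |UNIV :: 'a set| )"
proof (rule conjI)
  obtain D where D: "dense_subset_of (subtopology stone_topology (maximal_elements Ult meet)) D"
    "|D| <o |UNIV :: 'a set|" using assms(3) by blast
  note ex = ex_locally_isolated[OF assms(1,2) D]
  show "\<forall>\<kappa>::'k rel. regular_cardinal \<kappa> \<and> \<kappa> \<le>o |UNIV :: 'a set| \<longrightarrow>
    (\<exists>C::'a set. closed_discrete_in pointwise_topology C \<and> |C| =o \<kappa>)"
    using ex locally_isolated_closed_discrete by blast
  show "uncountable (UNIV :: 'a set) \<and> regular_cardinal |UNIV :: 'a set| \<longrightarrow>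
    (\<forall>G::'a set. generates_algebra G \<longrightarrow> (\<exists>p\<in>Ult. |p \<inter> G| =o |UNIV :: 'a set| ))
    \<and> \<not> corson TYPE('a) |UNIV :: 'a set|"
  proof
    assume unc: "uncountable (UNIV :: 'a set) \<and> regular_cardinal |UNIV :: 'a set|"
    \<comment> \<open>The first claim concerns cardinals over \<open>'k\<close>, so
      \<open>ex\<close> is instantiated anew at the cardinal of the algebra.\<close>
    then obtain C :: "'a set" where C: "locally_isolated C" "|C| =o |UNIV :: 'a set|"
      using ex[of "|UNIV :: 'a set|"] ordLeq_refl card_of_Card_order by blast
    have "\<not> |UNIV :: 'a set| \<le>o |UNIV :: nat set|"
      using unc by (simp add: card_of_ordLeq[symmetric] countable_def)
    then have nat: "|UNIV :: nat set| <o |UNIV :: 'a set|"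
      using card_of_not_less_iff[OF card_of_Card_order] by blast
    have large: "\<exists>p\<in>Ult. \<not> |p \<inter> G| <o |UNIV :: 'a set|" if "generates_algebra G" for G :: "'a set"
      using locally_isolated_not_small_traces[OF _ nat that _ C(1)] C(2) unc ordIso_iff_ordLeq by blast
    \<comment> \<open>A trace is never larger than the algebra, so a trace that is not smaller has
      full cardinality.\<close>
    then have "\<exists>p\<in>Ult. |p \<inter> G| =o |UNIV :: 'a set|" if "generates_algebra G" for G :: "'a set"
      using that card_of_not_less_iff[OF card_of_Card_order] card_of_mono1[of _ "UNIV :: 'a set"]
        ordIso_iff_ordLeq by blast
    moreover have "\<not> corson TYPE('a) |UNIV :: 'a set|"
      using large unfolding corson_def by (metis Int_commute)
    ultimately show "(\<forall>G::'a set. generates_algebra G \<longrightarrow> (\<exists>p\<in>Ult. |p \<inter> G| =o |UNIV :: 'a set| ))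
      \<and> \<not> corson TYPE('a) |UNIV :: 'a set|" by blast
  qed
qed

end
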